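(* There is an absolute constant $C$ such that the following holds. Let $f\colon\{-1,1\}^{n}\rightarrow [-1,1]$ be a symmetric function of degree $d$. If $n\geq 64d^{4}\log d$, then $\mathrm{Inf}[f]\leq d+C\sqrt{dn}\,e^{-t^{2}/4}$, where $t=\sqrt{n}\left(\frac{1}{4d^{2}}-\frac{2}{n}\right)$.
   Context: The degree of $f\colon\{-1,1\}^n\to\mathbb{R}$ is the degree of its unique multilinear polynomial representation. $f$ is symmetric if $f(\mathbf{x})$ depends only on $x_1+\cdots+x_n$. With $x\oplus e_i$ the point $x$ with $i$th coordinate flipped, $\mathrm{Inf}[f]=\sum_{i=1}^n\mathbb{E}_x\left|\frac{f(x)-f(x\oplus e_i)}{2}\right|$, $x$ uniform on $\{-1,1\}^n$. *)

theory Defs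
  imports "HOL-Probability.Probability"
begin

text \<open>
  The dimension is a natural number rather than a type, so that a constant can be chosen
  before it.
\<close>

definition cube :: "nat \<Rightarrow> (nat \<Rightarrow> real) set" where
  "cube n = {1..n} \<rightarrow>\<^sub>E {-1, 1}"

text \<open>
  A multilinear polynomial in \<open>x\<^sub>1, \<dots>, x\<^sub>n\<close> is given by its coefficients, indexed by the
  subsets of \<open>{1..n}\<close>: the coefficient at \<open>S\<close> belongs to the monomial \<open>\<Prod>i\<in>S. x\<^sub>i\<close>.
\<close>

definition multilinear_rep :: "nat \<Rightarrow> ((nat \<Rightarrow> real) \<Rightarrow> real) \<Rightarrow> (nat set \<Rightarrow> real) \<Rightarrow> bool" where
  "multilinear_rep n f c \<longleftrightarrow>
     (\<forall>S. \<not> S \<subseteq> {1..n} \<longrightarrow> c S = 0) \<and>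
     (\<forall>x\<in>cube n. f x = (\<Sum>S\<in>Pow {1..n}. c S * (\<Prod>i\<in>S. x i)))"

definition multilinear_coeff :: "nat \<Rightarrow> ((nat \<Rightarrow> real) \<Rightarrow> real) \<Rightarrow> nat set \<Rightarrow> real" where
  "multilinear_coeff n f = (THE c. multilinear_rep n f c)"

text \<open>The zero function gets degree 0.\<close>

definition cube_degree :: "nat \<Rightarrow> ((nat \<Rightarrow> real) \<Rightarrow> real) \<Rightarrow> nat" where
  "cube_degree n f =
     Max (insert 0 (card ` {S. S \<subseteq> {1..n} \<and> multilinear_coeff n f S \<noteq> 0}))"

definition cube_symmetric :: "nat \<Rightarrow> ((nat \<Rightarrow> real) \<Rightarrow> real) \<Rightarrow> bool" where
  "cube_symmetric n f \<longleftrightarrow>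
     (\<forall>x\<in>cube n. \<forall>y\<in>cube n. (\<Sum>i=1..n. x i) = (\<Sum>i=1..n. y i) \<longrightarrow> f x = f y)"

definition total_influence :: "nat \<Rightarrow> ((nat \<Rightarrow> real) \<Rightarrow> real) \<Rightarrow> real" where
  "total_influence n f =
     (\<Sum>i=1..n. measure_pmf.expectation (pmf_of_set (cube n))
        (\<lambda>x. \<bar>(f x - f (x(i := - x i))) / 2\<bar>))"

lemma finite_cube [simp]: "finite (cube n)"
  by (auto simp: cube_def intro: finite_PiE)

lemma sum_cube_prod_mult:
  assumes "S \<subseteq> {1..n}" "T \<subseteq> {1..n}"
  shows "(\<Sum>x\<in>cube n. (\<Prod>i\<in>S. x i) * (\<Prod>i\<in>T. x i)) = (if S = T then 2 ^ n else 0)"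
proof -
  let ?g = "\<lambda>i (y::real). (if i \<in> S then y else 1) * (if i \<in> T then y else 1)"
  have *: "(\<Prod>i\<in>U. x i) = (\<Prod>i=1..n. if i \<in> U then x i else 1)"
    if "U \<subseteq> {1..n}" for U and x :: "nat \<Rightarrow> real"
    using that by (simp add: prod.inter_restrict[symmetric] Int_absorb1)
  have "(\<Sum>x\<in>cube n. (\<Prod>i\<in>S. x i) * (\<Prod>i\<in>T. x i)) = (\<Sum>x\<in>cube n. \<Prod>i=1..n. ?g i (x i))"
    by (simp add: *[OF assms(1)] *[OF assms(2)] prod.distrib)
  also have "\<dots> = (\<Prod>i=1..n. \<Sum>y\<in>{-1, 1}. ?g i y)"
    unfolding cube_def by (rule prod_sum_PiE[symmetric]) auto
  also have "\<dots> = (\<Prod>i=1..n. if i \<in> S \<longleftrightarrow> i \<in> T then 2 else 0)"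
    by (intro prod.cong) auto
  also have "\<dots> = (if S = T then 2 ^ n else 0)"
  proof (cases "S = T")
    case False
    then obtain i where "i \<in> {1..n}" "\<not> (i \<in> S \<longleftrightarrow> i \<in> T)" using assms by blast
    then show ?thesis using False by (auto intro!: prod_zero)
  qed simp
  finally show ?thesis .
qed

lemma sum_Pow_prod_mult:
  assumes "x \<in> cube n" "y \<in> cube n"
  shows "(\<Sum>S\<in>Pow {1..n}. (\<Prod>i\<in>S. x i) * (\<Prod>i\<in>S. y i)) = (if x = y then 2 ^ n else 0)"
proof -
  have "(\<Sum>S\<in>Pow {1..n}. (\<Prod>i\<in>S. x i) * (\<Prod>i\<in>S. y i)) = (\<Prod>i=1..n. x i * y i + 1)"
    by (subst prod_add) (simp_all add: prod.distrib)
  also have "\<dots> = (\<Prod>i=1..n. if x i = y i then 2 else 0)"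
  proof (rule prod.cong[OF refl])
    fix i assume "i \<in> {1..n}"
    then have "x i \<in> {-1, 1}" "y i \<in> {-1, 1}"
      using assms unfolding cube_def by blast+
    then show "x i * y i + 1 = (if x i = y i then 2 else 0)" by auto
  qed
  also have "\<dots> = (if x = y then 2 ^ n else 0)"
  proof (cases "x = y")
    case False
    then obtain i where "i \<in> {1..n}" "x i \<noteq> y i"
      using assms unfolding cube_def by (meson PiE_ext)
    then show ?thesis using False by (auto intro!: prod_zero)
  qed simp
  finally show ?thesis .
qed

lemma multilinear_rep_ex1: "\<exists>!c. multilinear_rep n f c"
proof (rule ex_ex1I)
  let ?c = "\<lambda>S. if S \<subseteq> {1..n} then (\<Sum>y\<in>cube n. f y * (\<Prod>i\<in>S. y i)) / 2 ^ n else 0"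
  have "f x = (\<Sum>S\<in>Pow {1..n}. ?c S * (\<Prod>i\<in>S. x i))" if x: "x \<in> cube n" for x
  proof -
    have "(\<Sum>S\<in>Pow {1..n}. ?c S * (\<Prod>i\<in>S. x i)) =
      (\<Sum>S\<in>Pow {1..n}. \<Sum>y\<in>cube n. f y / 2 ^ n * ((\<Prod>i\<in>S. y i) * (\<Prod>i\<in>S. x i)))"
      by (intro sum.cong) (auto simp: sum_distrib_right sum_divide_distrib mult.assoc)
    also have "\<dots> = (\<Sum>y\<in>cube n. f y / 2 ^ n *
        (\<Sum>S\<in>Pow {1..n}. (\<Prod>i\<in>S. y i) * (\<Prod>i\<in>S. x i)))"
      by (subst sum.swap) (simp add: sum_distrib_left)
    also have "\<dots> = (\<Sum>y\<in>cube n. if y = x then f y else 0)"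
      by (intro sum.cong refl) (simp add: sum_Pow_prod_mult x del: One_nat_def)
    also have "\<dots> = f x" using x by simp
    finally show ?thesis by simp
  qed
  then show "\<exists>c. multilinear_rep n f c"
    unfolding multilinear_rep_def by (intro exI[of _ ?c]) auto
next
  have *: "c T = (\<Sum>x\<in>cube n. f x * (\<Prod>i\<in>T. x i)) / 2 ^ n"
    if c: "multilinear_rep n f c" and T: "T \<subseteq> {1..n}" for c T
  proof -
    have "(\<Sum>x\<in>cube n. f x * (\<Prod>i\<in>T. x i)) =
      (\<Sum>x\<in>cube n. \<Sum>S\<in>Pow {1..n}. c S * ((\<Prod>i\<in>S. x i) * (\<Prod>i\<in>T. x i)))"
      using c by (intro sum.cong) (auto simp: multilinear_rep_def sum_distrib_right mult.assoc)
    also have "\<dots> = (\<Sum>S\<in>Pow {1..n}. c S * (\<Sum>x\<in>cube n. (\<Prod>i\<in>S. x i) * (\<Prod>i\<in>T. x i)))"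
      by (subst sum.swap) (simp add: sum_distrib_left)
    also have "\<dots> = (\<Sum>S\<in>Pow {1..n}. if S = T then c S * 2 ^ n else 0)"
      by (intro sum.cong refl) (use T in \<open>simp add: sum_cube_prod_mult del: One_nat_def\<close>)
    also have "\<dots> = c T * 2 ^ n" using T by simp
    finally show ?thesis by simp
  qed
  fix c c' assume c: "multilinear_rep n f c" "multilinear_rep n f c'"
  show "c = c'"
  proof
    fix T show "c T = c' T"
    proof (cases "T \<subseteq> {1..n}")
      case True
      show ?thesis by (simp only: *[OF c(1) True] *[OF c(2) True])
    next
      case False
      then show ?thesis using c by (simp add: multilinear_rep_def)
    qed
  qed
qed

end

theory Submission
  imports Defs
begin

text \<open>
  A symmetric \<open>f\<close> of degree \<open>d\<close> has the form \<open>f x = P ((\<Sum>\<^sub>i x\<^sub>i) / n)\<close> with \<open>degree P \<le> d\<close>, and \<open>P\<close> is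
  bounded on \<open>[-1, 1]\<close> because it is bounded on a grid much finer than \<open>1 / d\<^sup>2\<close>. Bernstein's inequality
  then bounds \<open>P''\<close> near \<open>0\<close> by a multiple of \<open>d\<^sup>2\<close>, so on the window \<open>\<bar>u\<bar> \<le> 1 / (4 d\<^sup>2)\<close> either
  \<open>P'\<close> has constant sign or \<open>\<bar>P'\<bar> \<le> d\<close>. In the second case the window contributes at most \<open>d\<close> to the
  influence. In the first case absolute values may be dropped there, and up to the tail the influence is
  \<open>\<bar>\<Sum>\<^sub>i c\<^sub>i\<bar>\<close> with \<open>c\<^sub>i\<close> the degree-one coefficients; this is the derivative at \<open>0\<close> of the multilinear
  extension on the diagonal, hence at most \<open>d\<close> by Bernstein's inequality. The points outside the window
  have measure at most \<open>2 e\<^bsup>-t\<^sup>2/2\<^esup>\<close> by Hoeffding's bound, and as \<open>\<Sum>\<^sub>i E (D\<^sub>i f)\<^sup>2 \<le> d\<close>, Cauchy--Schwarz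
  shows that they contribute \<open>O (\<surd>(d n) e\<^bsup>-t\<^sup>2/4\<^esup>)\<close>.
\<close>

section \<open>Riesz interpolation and Bernstein's inequality\<close>

text \<open>For \<open>k < 2 * N\<close> these are the zeros of \<open>cos (N y)\<close> between
  \<open>0\<close> and \<open>2 pi\<close>.\<close>

definition riesz_node :: "nat \<Rightarrow> nat \<Rightarrow> real" where
  "riesz_node N k = (2 * real k + 1) * pi / (2 * real N)"

text \<open>As \<open>sin (N \<theta>\<^sub>k) = (-1)^k\<close> and
  \<open>1 - cos \<theta> = 2 sin^2 (\<theta> / 2)\<close>, this is the weight
  \<open>(-1)^k / (4 N sin^2 (\<theta>\<^sub>k / 2))\<close> of M. Riesz's interpolation formula.
  Keeping the sine in place of the sign lets product-to-sum identities apply.\<close>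

definition riesz_weight :: "nat \<Rightarrow> nat \<Rightarrow> real" where
  "riesz_weight N k = sin (real N * riesz_node N k) / (2 * real N * (1 - cos (riesz_node N k)))"

text \<open>Multiplied by \<open>2 sin \<alpha>\<close> the sum telescopes to
  \<open>sin (2 pi m) = 0\<close>; the range of \<open>m\<close> puts \<open>\<alpha>\<close>
  strictly between \<open>0\<close> and \<open>pi\<close>, so this factor can be cancelled.\<close>

lemma sum_cos_riesz_node:
  assumes "0 < m" "m < 2 * N"
  shows "(\<Sum>k<2*N. cos (real m * riesz_node N k)) = 0"
proof -
  define \<alpha> where "\<alpha> = real m * pi / (2 * real N)"
  have "0 < \<alpha>" "\<alpha> < pi"
    using assms by (auto simp: \<alpha>_def field_simps)
  then have s: "sin \<alpha> > 0" by (rule sin_gt_zero)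
  have N: "N > 0" using assms by simp
  have "2 * sin \<alpha> * cos (real m * riesz_node N k) = sin (2 * real (Suc k) * \<alpha>) - sin (2 * real k * \<alpha>)" for k
  proof -
    have e: "real m * riesz_node N k = (2 * real k + 1) * \<alpha>"
      by (simp add: riesz_node_def \<alpha>_def)
    have "sin (2 * real (Suc k) * \<alpha>) = sin ((2 * real k + 1) * \<alpha> + \<alpha>)"
         "sin (2 * real k * \<alpha>) = sin ((2 * real k + 1) * \<alpha> - \<alpha>)"
      by (simp_all add: algebra_simps)
    then show ?thesis unfolding e sin_add sin_diff by simp
  qed
  then have "2 * sin \<alpha> * (\<Sum>k<2*N. cos (real m * riesz_node N k))
      = (\<Sum>k<2*N. sin (2 * real (Suc k) * \<alpha>) - sin (2 * real k * \<alpha>))"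
    by (simp only: sum_distrib_left)
  also have "\<dots> = sin (2 * real (2 * N) * \<alpha>)"
    by (subst sum_lessThan_telescope) simp
  also have "2 * real (2 * N) * \<alpha> = 2 * pi * real m"
    using N by (simp add: \<alpha>_def)
  also have "sin (2 * pi * real m) = 0"
    using sin_npi2[of "2 * m"] by (simp add: mult_ac)
  finally show ?thesis using s by simp
qed

lemma cos_N_riesz_node: "N > 0 \<Longrightarrow> cos (real N * riesz_node N k) = 0"
proof -
  assume "N > 0"
  then have "real N * riesz_node N k = real k * pi + pi / 2"
    by (simp add: riesz_node_def field_simps)
  then show ?thesis by (simp add: cos_add)
qed

lemma sin_N_riesz_node: "N > 0 \<Longrightarrow> sin (real N * riesz_node N k) ^ 2 = 1"
  using sin_cos_squared_add[of "real N * riesz_node N k"] cos_N_riesz_node[of N k] by simp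

lemma cos_riesz_node_less_1:
  assumes "k < 2 * N"
  shows "cos (riesz_node N k) < 1"
proof -
  have "2 * real k + 1 < 4 * real N"
    using assms by linarith
  then have "(2 * real k + 1) * pi < 4 * real N * pi"
    by (rule mult_strict_right_mono) simp
  then have "0 < riesz_node N k / 2" "riesz_node N k / 2 < pi"
    using assms by (auto simp: riesz_node_def field_simps intro!: add_pos_nonneg)
  then have "sin (riesz_node N k / 2) > 0" by (rule sin_gt_zero)
  then have "sin (riesz_node N k / 2) ^ 2 > 0" by simp
  then show ?thesis
    using cos_double_sin[of "riesz_node N k / 2"] by simp
qed

lemma riesz_weight_mult:
  assumes "k < 2 * N"
  shows "riesz_weight N k * (1 - cos (riesz_node N k)) = sin (real N * riesz_node N k) / (2 * real N)"
  using cos_riesz_node_less_1[OF assms] by (simp add: riesz_weight_def)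

text \<open>The reflection \<open>\<theta> -> 2 pi - \<theta>\<close> permutes the nodes, fixes the
  cosines and negates \<open>sin (N \<theta>)\<close>, hence the weights. The sum equals its own
  negative.\<close>

lemma sum_riesz_weight_cos:
  assumes "N > 0"
  shows "(\<Sum>k<2*N. riesz_weight N k * cos (real j * riesz_node N k)) = 0" (is "?S = 0")
proof -
  have r: "riesz_node N (2 * N - Suc k) = 2 * pi - riesz_node N k" if "k < 2 * N" for k
    using that by (simp add: riesz_node_def of_nat_diff field_simps)
  have c: "cos (real m * (2 * pi - y)) = cos (real m * y)" 
      and s: "sin (real m * (2 * pi - y)) = - sin (real m * y)" for m y
    using sin_npi2[of "2 * m"] cos_npi2[of "2 * m"]
    by (simp_all add: right_diff_distrib cos_diff sin_diff mult_ac)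
  have "?S = (\<Sum>k<2*N. riesz_weight N (2 * N - Suc k) * cos (real j * riesz_node N (2 * N - Suc k)))"
    by (rule sum.nat_diff_reindex[symmetric])
  also have "\<dots> = (\<Sum>k<2*N. - (riesz_weight N k * cos (real j * riesz_node N k)))"
  proof (rule sum.cong[OF refl])
    fix k assume "k \<in> {..<2*N}"
    then have k: "k < 2 * N" by simp
    show "riesz_weight N (2 * N - Suc k) * cos (real j * riesz_node N (2 * N - Suc k)) =
       - (riesz_weight N k * cos (real j * riesz_node N k))"
      unfolding riesz_weight_def r[OF k] c s using c[of 1 "riesz_node N k"] by simp
  qed
  also have "\<dots> = - ?S" by (simp add: sum_negf)
  finally show ?thesis by simp
qed

text \<open>The second differences in \<open>j\<close> of the sum vanish for \<open>0 < j < N\<close>, so it is linear in \<open>j\<close>;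
  the slope is read off at \<open>j = N\<close>, where \<open>cos (N \<theta>\<^sub>k) = 0\<close>.\<close>

lemma sum_riesz_weight_sin:
  assumes N: "N > 0" and "j \<le> N"
  shows "(\<Sum>k<2*N. riesz_weight N k * sin (real j * riesz_node N k)) = real j"
proof -
  define A where "A j = (\<Sum>k<2*N. riesz_weight N k * sin (real j * riesz_node N k))" for j
  have step: "A (Suc (Suc j)) = 2 * A (Suc j) - A j" if "Suc j < N" for j
  proof -
    have "2 * A (Suc j) - A (Suc (Suc j)) - A j =
      (\<Sum>k<2*N. riesz_weight N k * (2 * sin (real (Suc j) * riesz_node N k) -
        sin (real (Suc (Suc j)) * riesz_node N k) - sin (real j * riesz_node N k)))"
      by (simp add: A_def sum_subtractf right_diff_distrib sum_distrib_left mult_ac)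
    also have "\<dots> = (\<Sum>k<2*N. (cos (real (N - Suc j) * riesz_node N k) -
        cos (real (N + Suc j) * riesz_node N k)) / (2 * real N))"
    proof (rule sum.cong[OF refl])
      fix k assume "k \<in> {..<2*N}"
      then have k: "k < 2 * N" by simp
      let ?y = "riesz_node N k"
      have e: "sin (real (Suc (Suc j)) * ?y) = sin (real (Suc j) * ?y + ?y)"
           "sin (real j * ?y) = sin (real (Suc j) * ?y - ?y)"
        by (simp_all add: algebra_simps)
      have "2 * sin (real (Suc j) * ?y) - sin (real (Suc (Suc j)) * ?y) - sin (real j * ?y)
        = (1 - cos ?y) * (2 * sin (real (Suc j) * ?y))"
        unfolding e sin_add sin_diff by (simp only: left_diff_distrib) simp
      then have "riesz_weight N k * (2 * sin (real (Suc j) * ?y) - sin (real (Suc (Suc j)) * ?y) - sin (real j * ?y))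
        = 2 * sin (real N * ?y) * sin (real (Suc j) * ?y) / (2 * real N)"
        by (simp only: mult.assoc[symmetric] riesz_weight_mult[OF k]) simp
      also have "2 * sin (real N * ?y) * sin (real (Suc j) * ?y) =
        cos (real N * ?y - real (Suc j) * ?y) - cos (real N * ?y + real (Suc j) * ?y)"
        unfolding cos_diff cos_add by simp
      also have "real N * ?y - real (Suc j) * ?y = real (N - Suc j) * ?y"
        using that by (simp add: of_nat_diff algebra_simps)
      also have "real N * ?y + real (Suc j) * ?y = real (N + Suc j) * ?y"
        by (simp add: algebra_simps)
      finally show "riesz_weight N k * (2 * sin (real (Suc j) * ?y) - sin (real (Suc (Suc j)) * ?y) - sin (real j * ?y))
        = (cos (real (N - Suc j) * ?y) - cos (real (N + Suc j) * ?y)) / (2 * real N)" .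
    qed
    also have "\<dots> = ((\<Sum>k<2*N. cos (real (N - Suc j) * riesz_node N k)) -
        (\<Sum>k<2*N. cos (real (N + Suc j) * riesz_node N k))) / (2 * real N)"
      by (simp only: sum_divide_distrib[symmetric] sum_subtractf)
    \<comment> \<open>Both frequencies \<open>N - (j + 1)\<close> and \<open>N + (j + 1)\<close> lie
      strictly between \<open>0\<close> and \<open>2 * N\<close>.\<close>
    also have "\<dots> = 0"
      using that by (subst (1 2) sum_cos_riesz_node) auto
    finally show ?thesis by simp
  qed
  have lin: "j \<le> N \<Longrightarrow> A j = real j * A 1" for j
  proof (induction j rule: less_induct)
    case (less j)
    consider "j = 0" | "j = 1" | i where "j = Suc (Suc i)"
      by (metis One_nat_def not0_implies_Suc)
    then show ?case
    proof cases
      case 1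
      then show ?thesis by (simp add: A_def)
    next
      case 2
      then show ?thesis by simp
    next
      case (3 i)
      then have "A i = real i * A 1" "A (Suc i) = real (Suc i) * A 1" "A j = 2 * A (Suc i) - A i"
        using less.IH[of i] less.IH[of "Suc i"] step[of i] less.prems by simp_all
      then show ?thesis unfolding 3 by (simp add: algebra_simps)
    qed
  qed
  have "A N - A (N - 1) = (\<Sum>k<2*N. riesz_weight N k * (sin (real N * riesz_node N k) -
        sin (real (N - 1) * riesz_node N k)))"
    by (simp add: A_def sum_subtractf right_diff_distrib)
  also have "\<dots> = (\<Sum>k<2*N. 1 / (2 * real N))"
  proof (rule sum.cong[OF refl])
    fix k assume "k \<in> {..<2*N}"
    then have k: "k < 2 * N" by simp
    let ?y = "riesz_node N k"
    have "sin (real (N - 1) * ?y) = sin (real N * ?y - ?y)"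
      using N by (simp add: of_nat_diff algebra_simps)
    then have "sin (real N * ?y) - sin (real (N - 1) * ?y) = (1 - cos ?y) * sin (real N * ?y)"
      using cos_N_riesz_node[OF N, of k] by (simp add: sin_diff algebra_simps)
    then have "riesz_weight N k * (sin (real N * ?y) - sin (real (N - 1) * ?y)) =
        sin (real N * ?y) ^ 2 / (2 * real N)"
      using riesz_weight_mult[OF k] by (simp add: mult.assoc[symmetric] power2_eq_square)
    then show "riesz_weight N k * (sin (real N * ?y) - sin (real (N - 1) * ?y)) = 1 / (2 * real N)"
      using sin_N_riesz_node[OF N] by simp
  qed
  also have "\<dots> = 1" using N by simp
  finally have "A N - A (N - 1) = 1" .
  moreover have "A N - A (N - 1) = A 1"
    using lin[of N] lin[of "N - 1"] N by (simp add: of_nat_diff algebra_simps)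
  ultimately show ?thesis using lin[OF assms(2)] by (simp add: A_def)
qed

text \<open>The sign of each weight is \<open>sin (N \<theta>\<^sub>k)\<close>, so this is the sine
  sum at \<open>j = N\<close>. The total becomes the constant in Bernstein's inequality.\<close>

lemma sum_abs_riesz_weight:
  assumes N: "N > 0"
  shows "(\<Sum>k<2*N. \<bar>riesz_weight N k\<bar>) = real N"
proof -
  have "(\<Sum>k<2*N. \<bar>riesz_weight N k\<bar>) = (\<Sum>k<2*N. riesz_weight N k * sin (real N * riesz_node N k))"
  proof (rule sum.cong[OF refl])
    fix k assume "k \<in> {..<2*N}"
    then have "1 - cos (riesz_node N k) > 0" using cos_riesz_node_less_1 by simp
    then have "2 * real N * (1 - cos (riesz_node N k)) > 0" using N by simp
    moreover have "sin (real N * riesz_node N k) = 1 \<or> sin (real N * riesz_node N k) = -1"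
      using sin_N_riesz_node[OF N, of k] by (simp add: power2_eq_1_iff)
    ultimately show "\<bar>riesz_weight N k\<bar> = riesz_weight N k * sin (real N * riesz_node N k)"
      by (auto simp: riesz_weight_def abs_div)
  qed
  then show ?thesis using sum_riesz_weight_sin[OF N order_refl] by simp
qed

section \<open>Trigonometric polynomials\<close>

text \<open>The span of the cosines and sines of frequency at most \<open>N\<close>, given by
  generators so that identities linear in the function follow by rule induction.\<close>

inductive trig_poly :: "nat \<Rightarrow> (real \<Rightarrow> real) \<Rightarrow> bool" for N where
  trig_poly_cos: "j \<le> N \<Longrightarrow> trig_poly N (\<lambda>y. cos (real j * y))"
| trig_poly_sin: "j \<le> N \<Longrightarrow> trig_poly N (\<lambda>y. sin (real j * y))"
| trig_poly_add: "trig_poly N S \<Longrightarrow> trig_poly N T \<Longrightarrow> trig_poly N (\<lambda>y. S y + T y)"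
| trig_poly_cmult: "trig_poly N T \<Longrightarrow> trig_poly N (\<lambda>y. c * T y)"

lemma trig_poly_mono: "trig_poly N T \<Longrightarrow> N \<le> M \<Longrightarrow> trig_poly M T"
proof (induction rule: trig_poly.induct)
  case (trig_poly_cos j)
  then show ?case by (intro trig_poly.trig_poly_cos) simp
next
  case (trig_poly_sin j)
  then show ?case by (intro trig_poly.trig_poly_sin) simp
next
  case (trig_poly_add S T)
  then show ?case by (intro trig_poly.trig_poly_add)
next
  case (trig_poly_cmult T c)
  then show ?case by (intro trig_poly.trig_poly_cmult)
qed

lemma trig_poly_const: "trig_poly N (\<lambda>y. c)"
  using trig_poly_cmult[OF trig_poly_cos[of 0 N], of c] by simp

lemma trig_poly_sum: "(\<And>i. i \<in> I \<Longrightarrow> trig_poly N (T i)) \<Longrightarrow> trig_poly N (\<lambda>y. \<Sum>i\<in>I. T i y)"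
  by (induction I rule: infinite_finite_induct) (simp_all add: trig_poly_const trig_poly_add)

text \<open>Product-to-sum formulas turn frequency \<open>j\<close> into \<open>j + 1\<close> and
  \<open>j - 1\<close>; \<open>j = 0\<close> is separate because it has no natural
  predecessor.\<close>

lemma trig_poly_cos_mult: "trig_poly N T \<Longrightarrow> trig_poly (Suc N) (\<lambda>y. cos y * T y)"
proof (induction rule: trig_poly.induct)
  case (trig_poly_cos j)
  show ?case
  proof (cases j)
    case 0
    then show ?thesis using trig_poly.trig_poly_cos[of 1 "Suc N"] by simp
  next
    case (Suc i)
    have "(\<lambda>y. cos y * cos (real j * y)) =
      (\<lambda>y. (1/2) * cos (real (Suc j) * y) + (1/2) * cos (real i * y))"
    proof
      fix y
      have "real (Suc j) * y = real j * y + y" "real i * y = real j * y - y"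
        by (simp_all add: Suc algebra_simps)
      then show "cos y * cos (real j * y) = (1/2) * cos (real (Suc j) * y) + (1/2) * cos (real i * y)"
        by (simp only: cos_add cos_diff) (simp add: field_simps)
    qed
    moreover have "trig_poly (Suc N) (\<lambda>y. (1/2) * cos (real (Suc j) * y) + (1/2) * cos (real i * y))"
      using trig_poly_cos Suc
      by (intro trig_poly.trig_poly_add trig_poly.trig_poly_cmult trig_poly.trig_poly_cos) auto
    ultimately show ?thesis by (simp only:)
  qed
next
  case (trig_poly_sin j)
  show ?case
  proof (cases j)
    case 0
    then show ?thesis by (simp add: trig_poly_const)
  next
    case (Suc i)
    have "(\<lambda>y. cos y * sin (real j * y)) =
      (\<lambda>y. (1/2) * sin (real (Suc j) * y) + (1/2) * sin (real i * y))"
    proof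
      fix y
      have "real (Suc j) * y = real j * y + y" "real i * y = real j * y - y"
        by (simp_all add: Suc algebra_simps)
      then show "cos y * sin (real j * y) = (1/2) * sin (real (Suc j) * y) + (1/2) * sin (real i * y)"
        by (simp only: sin_add sin_diff) (simp add: field_simps)
    qed
    moreover have "trig_poly (Suc N) (\<lambda>y. (1/2) * sin (real (Suc j) * y) + (1/2) * sin (real i * y))"
      using trig_poly_sin Suc
      by (intro trig_poly.trig_poly_add trig_poly.trig_poly_cmult trig_poly.trig_poly_sin) auto
    ultimately show ?thesis by (simp only:)
  qed
next
  case (trig_poly_add S T)
  then show ?case using trig_poly.trig_poly_add[OF trig_poly_add.IH]
    by (simp add: distrib_left)
next
  case (trig_poly_cmult T c)
  then show ?case using trig_poly.trig_poly_cmult[OF trig_poly_cmult.IH, of c]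
    by (simp add: mult_ac)
qed

lemma trig_poly_poly_cos:
  assumes "degree p \<le> N"
  shows "trig_poly N (\<lambda>y. poly p (cos y))"
proof -
  have *: "trig_poly m (\<lambda>y. cos y ^ m)" for m
    by (induction m) (simp_all add: trig_poly_const trig_poly_cos_mult)
  have "trig_poly N (\<lambda>y. \<Sum>i\<le>degree p. coeff p i * cos y ^ i)"
  proof (rule trig_poly_sum)
    fix i assume "i \<in> {..degree p}"
    then have "i \<le> N" using assms by simp
    then show "trig_poly N (\<lambda>y. coeff p i * cos y ^ i)"
      by (rule trig_poly_cmult[OF trig_poly_mono[OF *]])
  qed
  then show ?thesis by (simp add: poly_altdef)
qed

text \<open>Both sides of the interpolation formula are linear in \<open>T\<close>, and on the
  generators the addition formulas reduce it to the two weight sums \<open>0\<close> and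
  \<open>j\<close>. The derivative is recorded as a \<open>trig_poly N\<close> so that Bernstein's
  inequality can be iterated.\<close>

lemma trig_poly_riesz:
  assumes N: "N > 0"
  shows "trig_poly N T \<Longrightarrow> \<exists>T'. trig_poly N T' \<and> (\<forall>y. (T has_real_derivative T' y) (at y)) \<and>
    (\<forall>y. T' y = (\<Sum>k<2*N. riesz_weight N k * T (y + riesz_node N k)))"
proof (induction rule: trig_poly.induct)
  case (trig_poly_cos j)
  have "(\<Sum>k<2*N. riesz_weight N k * cos (real j * (y + riesz_node N k))) =
    cos (real j * y) * (\<Sum>k<2*N. riesz_weight N k * cos (real j * riesz_node N k)) -
    sin (real j * y) * (\<Sum>k<2*N. riesz_weight N k * sin (real j * riesz_node N k))" for y
    by (simp add: distrib_left cos_add sum_distrib_left sum_subtractf algebra_simps)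
  then have e: "(\<Sum>k<2*N. riesz_weight N k * cos (real j * (y + riesz_node N k))) =
    (- real j) * sin (real j * y)" for y
    using N trig_poly_cos by (simp add: sum_riesz_weight_cos sum_riesz_weight_sin)
  show ?case
  proof (intro exI conjI allI)
    show "trig_poly N (\<lambda>y. (- real j) * sin (real j * y))"
      using trig_poly_cos by (intro trig_poly.intros)
  qed (use e in \<open>auto intro!: derivative_eq_intros\<close>)
next
  case (trig_poly_sin j)
  have "(\<Sum>k<2*N. riesz_weight N k * sin (real j * (y + riesz_node N k))) =
    sin (real j * y) * (\<Sum>k<2*N. riesz_weight N k * cos (real j * riesz_node N k)) +
    cos (real j * y) * (\<Sum>k<2*N. riesz_weight N k * sin (real j * riesz_node N k))" for y
    by (simp add: distrib_left sin_add sum_distrib_left sum.distrib algebra_simps)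
  then have e: "(\<Sum>k<2*N. riesz_weight N k * sin (real j * (y + riesz_node N k))) =
    real j * cos (real j * y)" for y
    using N trig_poly_sin by (simp add: sum_riesz_weight_cos sum_riesz_weight_sin)
  show ?case
  proof (intro exI conjI allI)
    show "trig_poly N (\<lambda>y. real j * cos (real j * y))"
      using trig_poly_sin by (intro trig_poly.intros)
  qed (use e in \<open>auto intro!: derivative_eq_intros\<close>)
next
  case (trig_poly_add S T)
  then obtain S' T' where ST: "trig_poly N S'" "trig_poly N T'"
    "\<And>y. (S has_real_derivative S' y) (at y)" "\<And>y. (T has_real_derivative T' y) (at y)"
    "\<And>y. S' y = (\<Sum>k<2*N. riesz_weight N k * S (y + riesz_node N k))"
    "\<And>y. T' y = (\<Sum>k<2*N. riesz_weight N k * T (y + riesz_node N k))"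
    by blast
  show ?case
  proof (intro exI conjI allI)
    show "trig_poly N (\<lambda>y. S' y + T' y)" by (rule trig_poly.trig_poly_add[OF ST(1,2)])
  qed (use ST(3-) in \<open>auto intro: DERIV_add simp: distrib_left sum.distrib\<close>)
next
  case (trig_poly_cmult T c)
  then obtain T' where T: "trig_poly N T'" "\<And>y. (T has_real_derivative T' y) (at y)"
    "\<And>y. T' y = (\<Sum>k<2*N. riesz_weight N k * T (y + riesz_node N k))"
    by blast
  show ?case
  proof (intro exI conjI allI)
    show "trig_poly N (\<lambda>y. c * T' y)" by (rule trig_poly.trig_poly_cmult[OF T(1)])
    show "((\<lambda>y. c * T y) has_real_derivative c * T' y) (at y)" for y
      by (rule DERIV_cmult[OF T(2)])
    show "c * T' y = (\<Sum>k<2*N. riesz_weight N k * (c * T (y + riesz_node N k)))" for y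
      by (simp add: T(3) sum_distrib_left mult_ac)
  qed
qed

lemma trig_poly_bernstein:
  assumes "N > 0" "trig_poly N T" "\<And>y. \<bar>T y\<bar> \<le> M"
  obtains T' where "trig_poly N T'" "\<And>y. (T has_real_derivative T' y) (at y)"
    "\<And>y. \<bar>T' y\<bar> \<le> real N * M"
proof -
  obtain T' where T': "trig_poly N T'" "\<And>y. (T has_real_derivative T' y) (at y)"
    "\<And>y. T' y = (\<Sum>k<2*N. riesz_weight N k * T (y + riesz_node N k))"
    using trig_poly_riesz[OF assms(1,2)] by blast
  have "\<bar>T' y\<bar> \<le> real N * M" for y
  proof -
    have "\<bar>T' y\<bar> \<le> (\<Sum>k<2*N. \<bar>riesz_weight N k\<bar> * M)"
      unfolding T'(3) by (rule order_trans[OF sum_abs])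
        (auto simp: abs_mult intro!: sum_mono mult_left_mono assms(3))
    then show ?thesis
      using sum_abs_riesz_weight[OF assms(1)] by (simp add: sum_distrib_right[symmetric])
  qed
  with T' that show ?thesis by blast
qed

section \<open>Derivative bounds for algebraic polynomials\<close>

text \<open>Up to sign the two expressions are the first and second derivatives in \<open>y\<close>
  of \<open>p (cos y)\<close>, so Bernstein's inequality is applied once and twice.\<close>

lemma poly_cos_derivatives_bound:
  fixes p :: "real poly"
  assumes N: "N > 0" and deg: "degree p \<le> N" and b: "\<And>u. \<bar>u\<bar> \<le> 1 \<Longrightarrow> \<bar>poly p u\<bar> \<le> M"
  shows "\<bar>poly (pderiv p) (cos y) * sin y\<bar> \<le> real N * M"
    and "\<bar>poly (pderiv (pderiv p)) (cos y) * sin y ^ 2 - poly (pderiv p) (cos y) * cos y\<bar> \<le> real N ^ 2 * M"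
proof -
  obtain T' where T': "trig_poly N T'" "\<And>y. ((\<lambda>y. poly p (cos y)) has_real_derivative T' y) (at y)"
    "\<And>y. \<bar>T' y\<bar> \<le> real N * M"
    by (rule trig_poly_bernstein[OF N trig_poly_poly_cos[OF deg], of M]) (auto intro: b)
  have "((\<lambda>y. poly p (cos y)) has_real_derivative - (poly (pderiv p) (cos y) * sin y)) (at y)" for y
    by (auto intro!: derivative_eq_intros)
  then have e: "T' = (\<lambda>y. - (poly (pderiv p) (cos y) * sin y))"
    using DERIV_unique T'(2) by blast
  then show "\<bar>poly (pderiv p) (cos y) * sin y\<bar> \<le> real N * M"
    using T'(3)[of y] by simp
  obtain T'' where T'': "\<And>y. (T' has_real_derivative T'' y) (at y)"
    "\<And>y. \<bar>T'' y\<bar> \<le> real N * (real N * M)"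
    by (rule trig_poly_bernstein[OF N T'(1), of "real N * M"]) (auto intro: T'(3))
  have "(T' has_real_derivative (poly (pderiv (pderiv p)) (cos y) * sin y ^ 2 - poly (pderiv p) (cos y) * cos y)) (at y)"
    unfolding e by (auto intro!: derivative_eq_intros simp: power2_eq_square)
  then have "T'' y = poly (pderiv (pderiv p)) (cos y) * sin y ^ 2 - poly (pderiv p) (cos y) * cos y"
    using DERIV_unique T''(1) by blast
  then show "\<bar>poly (pderiv (pderiv p)) (cos y) * sin y ^ 2 - poly (pderiv p) (cos y) * cos y\<bar> \<le> real N ^ 2 * M"
    using T''(2)[of y] by (simp add: power2_eq_square mult.assoc)
qed

text \<open>The coefficient is \<open>q'(0)\<close>, which the first derivative bound controls at
  \<open>y = pi / 2\<close>, where the cosine is \<open>0\<close> and the sine is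
  \<open>1\<close>.\<close>

lemma poly_derivative_at_0_le:
  fixes q :: "real poly"
  assumes "degree q \<le> d" "\<And>u. \<bar>u\<bar> \<le> 1 \<Longrightarrow> \<bar>poly q u\<bar> \<le> M"
  shows "\<bar>coeff q 1\<bar> \<le> real d * M"
proof (cases "d = 0")
  case True
  then have "coeff q 1 = 0" using assms(1) by (intro coeff_eq_0) simp
  then show ?thesis using True by simp
next
  case False
  then show ?thesis
    using poly_cos_derivatives_bound(1)[of d q M "pi/2"] assms
    by (simp add: poly_0_coeff_0 coeff_pderiv)
qed

text \<open>The difference of cosines is \<open>2 sin a sin b\<close> with \<open>a\<close> the
  half-sum and \<open>b\<close> the half-difference of the angles, and
  \<open>sin a >= sin b >= b / 2\<close>. It turns closeness of cosines into closeness of angles,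
  even near the endpoints.\<close>

lemma cos_diff_ge:
  assumes "0 \<le> \<beta>" "\<beta> \<le> \<alpha>" "\<alpha> \<le> pi"
  shows "(\<alpha> - \<beta>) ^ 2 / 8 \<le> cos \<beta> - cos \<alpha>"
proof -
  \<comment> \<open>Here \<open>sin y = 2 sin (y/2) cos (y/2)\<close>, the mean value theorem gives
    \<open>sin (y/2) >= (y/2) cos (y/2)\<close>, and \<open>cos^2 (y/2) >= 1/2\<close> on this
    range.\<close>
  have half: "y / 2 \<le> sin y" if "0 \<le> y" "y \<le> pi / 2" for y
  proof -
    have c: "cos (y / 2) ^ 2 \<ge> 1 / 2"
      using cos_double_cos[of "y / 2"] cos_ge_zero[of y] that by simp
    have c0: "cos (y / 2) \<ge> 0" using that by (intro cos_ge_zero) auto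
    have "sin (y / 2) \<ge> (y / 2) * cos (y / 2)"
    proof (cases "y = 0")
      case False
      then have "0 < y / 2" using that by simp
      then obtain z where z: "0 < z" "z < y / 2" "sin (y / 2) - sin 0 = (y / 2 - 0) * cos z"
        using MVT2[of 0 "y / 2" sin cos] by (auto intro: DERIV_sin)
      then have "cos (y / 2) \<le> cos z" using that by (intro cos_monotone_0_pi_le) auto
      then show ?thesis using z that by (simp add: mult_left_mono)
    qed simp
    then have "(y / 2) * cos (y / 2) * cos (y / 2) \<le> sin (y / 2) * cos (y / 2)"
      by (rule mult_right_mono[OF _ c0])
    moreover have "sin y = 2 * (sin (y / 2) * cos (y / 2))"
      using sin_double[of "y / 2"] by simp
    moreover have "(y / 2) * (1 / 2) \<le> (y / 2) * cos (y / 2) ^ 2"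
      using that c by (intro mult_left_mono) auto
    ultimately show ?thesis by (simp add: power2_eq_square mult.assoc)
  qed
  define a b where "a = (\<alpha> + \<beta>) / 2" and "b = (\<alpha> - \<beta>) / 2"
  have b: "0 \<le> b" "b \<le> pi / 2" "b / 2 \<le> sin b"
    using assms half[of b] by (auto simp: b_def)
  have "sin a - sin b = 2 * sin (\<beta> / 2) * cos (\<alpha> / 2)"
    by (subst sin_diff_sin) (simp add: a_def b_def add_divide_distrib diff_divide_distrib)
  moreover have "sin (\<beta> / 2) \<ge> 0" "cos (\<alpha> / 2) \<ge> 0"
    using assms by (auto intro!: sin_ge_zero cos_ge_zero)
  ultimately have "sin b \<le> sin a"
    by (metis diff_ge_0_iff_ge mult_nonneg_nonneg zero_le_numeral)
  have "(\<alpha> - \<beta>) ^ 2 / 8 = 2 * (b / 2) * (b / 2)"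
    by (simp add: b_def power2_eq_square)
  also have "\<dots> \<le> 2 * sin a * sin b"
    using b \<open>sin b \<le> sin a\<close> by (intro mult_mono) auto
  also have "\<dots> = cos \<beta> - cos \<alpha>"
    by (subst cos_diff_cos) (simp add: a_def b_def add.commute)
  finally show ?thesis .
qed

text \<open>At a maximum of \<open>\<bar>p (cos y)\<bar>\<close> the derivative in \<open>y\<close> vanishes, so by Bernstein's inequality for
  the second derivative the value there differs little from that at the nearest grid point.\<close>

lemma poly_bounded_of_grid:
  fixes p :: "real poly"
  assumes d: "d > 0" and deg: "degree p \<le> d" and n: "real n \<ge> 16 * real d ^ 2"
    and grid: "\<And>m. m \<le> n \<Longrightarrow> \<bar>poly p ((real n - 2 * real m) / real n)\<bar> \<le> 1"
    and u: "\<bar>u\<bar> \<le> 1"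
  shows "\<bar>poly p u\<bar> \<le> 2"
proof -
  have n0: "real n > 0" using n d by (smt (verit) of_nat_0_less_iff zero_less_power)
  have "continuous_on {-1..1::real} (\<lambda>u. \<bar>poly p u\<bar>)" by (intro continuous_intros)
  then obtain v where v: "v \<in> {-1..1}" "\<And>u. u \<in> {-1..1::real} \<Longrightarrow> \<bar>poly p u\<bar> \<le> \<bar>poly p v\<bar>"
    using continuous_attains_sup[of "{-1..1::real}" "\<lambda>u. \<bar>poly p u\<bar>"] by fastforce
  define M where "M = \<bar>poly p v\<bar>"
  have M: "\<bar>poly p u\<bar> \<le> M" if "\<bar>u\<bar> \<le> 1" for u
    using v(2)[of u] that by (simp add: M_def abs_le_iff)
  define \<theta> where "\<theta> = arccos v"
  have \<theta>: "0 \<le> \<theta>" "\<theta> \<le> pi" "cos \<theta> = v"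
    using v(1) by (auto simp: \<theta>_def arccos_lbound arccos_ubound)
  define D where "D y = - (poly (pderiv p) (cos y) * sin y)" for y
  have D: "((\<lambda>y. poly p (cos y)) has_real_derivative D y) (at y)" for y
    unfolding D_def by (auto intro!: derivative_eq_intros)
  \<comment> \<open>This holds even if \<open>v\<close> is an endpoint of \<open>[-1, 1]\<close>: as
    a function of \<open>y\<close> on the whole line, \<open>p (cos y)\<close> has an interior
    extremum at \<open>\<theta>\<close>.\<close>
  have "D \<theta> = 0"
  proof (cases "poly p v \<ge> 0")
    case True
    have "poly p (cos y) \<le> poly p (cos \<theta>)" for y
      using M[of "cos y"] True \<theta>(3) by (simp add: M_def)
    then show ?thesis by (intro DERIV_local_max[OF D, of 1]) auto
  next
    case False
    have "poly p (cos \<theta>) \<le> poly p (cos y)" for y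
      using M[of "cos y"] False \<theta>(3) by (simp add: M_def)
    then show ?thesis by (intro DERIV_local_min[OF D, of 1]) auto
  qed
  have Db: "\<bar>D y\<bar> \<le> real d ^ 2 * M * \<bar>y - \<theta>\<bar>" for y
  proof -
    have "norm (D y - D \<theta>) \<le> (real d ^ 2 * M) * norm (y - \<theta>)"
    proof (rule field_differentiable_bound[of UNIV])
      fix z
      show "(D has_field_derivative (poly (pderiv (pderiv p)) (cos z) * sin z ^ 2 - poly (pderiv p) (cos z) * cos z)) (at z within UNIV)"
        unfolding D_def by (auto intro!: derivative_eq_intros simp: power2_eq_square)
      show "norm (poly (pderiv (pderiv p)) (cos z) * sin z ^ 2 - poly (pderiv p) (cos z) * cos z) \<le> real d ^ 2 * M"
        using poly_cos_derivatives_bound(2)[OF d deg M] by simp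
    qed auto
    then show ?thesis using \<open>D \<theta> = 0\<close> by simp
  qed
  \<comment> \<open>The real index solving \<open>(n - 2 w) / n = v\<close>; rounding it moves the
    grid point by at most \<open>1 / n\<close>.\<close>
  define w where "w = (1 - v) * real n / 2"
  have "(1 - v) * real n \<le> 2 * real n" using v(1) by (intro mult_right_mono) auto
  then have w: "0 \<le> w" "w \<le> real n" using v(1) by (auto simp: w_def)
  define m where "m = nat (round w)"
  have "0 \<le> round w" using round_mono[OF w(1)] by simp
  moreover have "round w \<le> int n" using round_mono[OF w(2)] by simp
  ultimately have m: "m \<le> n" "\<bar>real m - w\<bar> \<le> 1 / 2"
    using of_int_round_abs_le[of w] by (auto simp: m_def)
  define v' where "v' = (real n - 2 * real m) / real n"
  have v': "\<bar>v'\<bar> \<le> 1" using m(1) n0 by (auto simp: v'_def field_simps abs_le_iff)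
  have "v' - v = 2 * (w - real m) / real n"
    using n0 by (simp add: v'_def w_def field_simps)
  then have "\<bar>v' - v\<bar> = \<bar>2 * (w - real m)\<bar> / real n" by (simp only: abs_divide abs_of_nat)
  also have "\<bar>2 * (w - real m)\<bar> = 2 * \<bar>real m - w\<bar>"
    by (simp add: abs_mult abs_minus_commute del: right_diff_distrib_numeral)
  also have "2 * \<bar>real m - w\<bar> / real n \<le> 1 / real n"
    using m(2) by (intro divide_right_mono) auto
  finally have vv': "\<bar>v' - v\<bar> \<le> 1 / real n" .
  define \<phi> where "\<phi> = arccos v'"
  have \<phi>: "0 \<le> \<phi>" "\<phi> \<le> pi" "cos \<phi> = v'"
    using v' by (auto simp: \<phi>_def abs_le_iff arccos_lbound arccos_ubound)
  have "(\<phi> - \<theta>) ^ 2 / 8 \<le> \<bar>v' - v\<bar>"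
  proof (cases "\<theta> \<le> \<phi>")
    case True
    then show ?thesis using cos_diff_ge[of \<theta> \<phi>] \<theta> \<phi> by linarith
  next
    case False
    then show ?thesis
      using cos_diff_ge[of \<phi> \<theta>] \<theta> \<phi> power2_commute[of \<phi> \<theta>] by linarith
  qed
  then have \<delta>: "(\<phi> - \<theta>) ^ 2 \<le> 8 / real n" using vv' by simp
  have "norm (poly p (cos \<phi>) - poly p (cos \<theta>)) \<le> (real d ^ 2 * M * \<bar>\<phi> - \<theta>\<bar>) * norm (\<phi> - \<theta>)"
  proof (rule field_differentiable_bound[of "cball \<theta> \<bar>\<phi> - \<theta>\<bar>"])
    fix z assume z: "z \<in> cball \<theta> \<bar>\<phi> - \<theta>\<bar>"
    show "((\<lambda>y. poly p (cos y)) has_field_derivative D z) (at z within cball \<theta> \<bar>\<phi> - \<theta>\<bar>)"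
      by (rule has_field_derivative_at_within[OF D])
    have "\<bar>z - \<theta>\<bar> \<le> \<bar>\<phi> - \<theta>\<bar>" using z by (auto simp: dist_real_def)
    then have "real d ^ 2 * M * \<bar>z - \<theta>\<bar> \<le> real d ^ 2 * M * \<bar>\<phi> - \<theta>\<bar>"
      by (intro mult_left_mono) (auto simp: M_def)
    then show "norm (D z) \<le> real d ^ 2 * M * \<bar>\<phi> - \<theta>\<bar>" using Db[of z] by simp
  qed (auto simp: dist_real_def)
  then have "\<bar>poly p v' - poly p v\<bar> \<le> real d ^ 2 * M * (\<phi> - \<theta>) ^ 2"
    by (simp add: \<theta> \<phi> power2_eq_square mult_ac)
  also have "\<dots> \<le> real d ^ 2 * M * (8 / real n)"
    by (intro mult_left_mono \<delta>) (auto simp: M_def)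
  \<comment> \<open>The hypothesis \<open>n >= 16 d^2\<close> enters here; then
    \<open>M <= 1 + M / 2\<close> yields the bound \<open>2\<close>.\<close>
  also have "\<dots> \<le> M / 2"
  proof -
    have "M * (16 * real d ^ 2) \<le> M * real n"
      by (intro mult_left_mono n) (auto simp: M_def)
    then show ?thesis using n0 by (simp add: field_simps)
  qed
  finally have "\<bar>poly p v' - poly p v\<bar> \<le> M / 2" .
  moreover have "\<bar>poly p v'\<bar> \<le> 1" using grid[OF m(1)] by (simp only: v'_def)
  ultimately have "M \<le> 2" unfolding M_def by linarith
  then show ?thesis using M[OF u] by simp
qed

text \<open>Near \<open>0\<close> the sine of \<open>arccos u\<close> is bounded below. The first
  derivative bound gives \<open>|p'| <= 4 d\<close>, so the second gives
  \<open>(15/16) |p''| <= 2 d^2 + d / 4\<close>.\<close>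

lemma poly_second_derivative_central:
  fixes p :: "real poly"
  assumes d: "d \<ge> 2" and deg: "degree p \<le> d" and b: "\<And>u. \<bar>u\<bar> \<le> 1 \<Longrightarrow> \<bar>poly p u\<bar> \<le> 2"
    and u: "\<bar>u\<bar> \<le> 1 / (4 * real d ^ 2)"
  shows "\<bar>poly (pderiv (pderiv p)) u\<bar> \<le> 3 * real d ^ 2"
proof -
  let ?p1 = "poly (pderiv p) u" and ?p2 = "poly (pderiv (pderiv p)) u"
  have d2: "real d ^ 2 \<ge> 4" using power_mono[of 2 "real d" 2] d by simp
  have dd: "real d \<le> real d ^ 2" using d by (simp add: power2_eq_square)
  have "1 / (4 * real d ^ 2) \<le> 1 / 16" using d2 d by (intro divide_left_mono) auto
  then have u16: "\<bar>u\<bar> \<le> 1 / 16" using u by linarith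
  define y where "y = arccos u"
  have y: "0 \<le> y" "y \<le> pi" "cos y = u"
    using u16 by (auto simp: y_def abs_le_iff arccos_lbound arccos_ubound)
  have s0: "0 \<le> sin y" using y by (intro sin_ge_zero)
  have "u ^ 2 \<le> (1 / 16) ^ 2" using u16 by (metis abs_ge_zero power2_abs power_mono)
  then have s2: "sin y ^ 2 \<ge> 15 / 16"
    using sin_cos_squared_add[of y] y(3) by (simp add: power2_eq_square)
  have s1: "sin y \<ge> 1 / 2"
  proof (rule ccontr)
    assume "\<not> sin y \<ge> 1 / 2"
    then have "sin y ^ 2 \<le> (1 / 2) ^ 2" using s0 by (intro power_mono) auto
    then show False using s2 by (simp add: power2_eq_square)
  qed
  have d0: "d > 0" using d by simp
  have "\<bar>?p1\<bar> * (1 / 2) \<le> \<bar>?p1\<bar> * sin y" by (intro mult_left_mono s1) auto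
  also have "\<dots> \<le> real d * 2"
    using poly_cos_derivatives_bound(1)[OF d0 deg b, of y] y s0 by (simp add: abs_mult)
  finally have p1: "\<bar>?p1\<bar> \<le> 4 * real d" by simp
  have "\<bar>?p1 * u\<bar> \<le> (4 * real d) * (1 / 16)"
    unfolding abs_mult by (intro mult_mono p1 u16) auto
  moreover have "\<bar>?p2 * sin y ^ 2 - ?p1 * u\<bar> \<le> real d ^ 2 * 2"
    using poly_cos_derivatives_bound(2)[OF d0 deg b, of y] y by simp
  moreover have "\<bar>?p2 * sin y ^ 2\<bar> \<ge> \<bar>?p2\<bar> * (15 / 16)"
    unfolding abs_mult by (intro mult_mono s2) (use s2 in auto)
  ultimately show ?thesis using dd by linarith
qed

section \<open>Fourier analysis on the cube\<close>

abbreviation chi :: "nat set \<Rightarrow> (nat \<Rightarrow> real) \<Rightarrow> real" where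
  "chi S x \<equiv> \<Prod>i\<in>S. x i"

text \<open>On the cube this is \<open>x i\<close> times the partial derivative of the multilinear
  extension. Hence \<open>x i * cube_deriv f i x\<close> carries the sign of the change of
  \<open>f\<close> as coordinate \<open>i\<close> goes from \<open>-1\<close> to
  \<open>1\<close>.\<close>

definition cube_deriv :: "((nat \<Rightarrow> real) \<Rightarrow> real) \<Rightarrow> nat \<Rightarrow> (nat \<Rightarrow> real) \<Rightarrow> real" where
  "cube_deriv f i x = (f x - f (x(i := - x i))) / 2"

lemma card_cube: "card (cube n) = 2 ^ n"
  by (simp add: cube_def card_PiE numeral_2_eq_2)

lemma cube_coord: "x \<in> cube n \<Longrightarrow> i \<in> {1..n} \<Longrightarrow> x i = 1 \<or> x i = -1"
  by (auto simp: cube_def PiE_def Pi_def)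

lemma cube_coord_sq: "x \<in> cube n \<Longrightarrow> i \<in> {1..n} \<Longrightarrow> x i * x i = 1"
  using cube_coord by fastforce

lemma cube_flip: "x \<in> cube n \<Longrightarrow> i \<in> {1..n} \<Longrightarrow> x(i := - x i) \<in> cube n"
  using cube_coord[of x n i] by (auto simp: cube_def PiE_def Pi_def extensional_def)

lemma total_influence_eq:
  "total_influence n f = (\<Sum>i=1..n. \<Sum>x\<in>cube n. \<bar>cube_deriv f i x\<bar>) / 2 ^ n"
proof -
  have "cube n \<noteq> {}" using card_cube[of n] by auto
  then show ?thesis
    by (simp add: total_influence_def cube_deriv_def integral_pmf_of_set card_cube sum_divide_distrib mult.commute)
qed

lemma cube_expansion:
  "x \<in> cube n \<Longrightarrow> f x = (\<Sum>S\<in>Pow {1..n}. multilinear_coeff n f S * chi S x)"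
  using theI'[OF multilinear_rep_ex1[of n f]]
  by (simp add: multilinear_coeff_def multilinear_rep_def)

lemma sum_cube_expansion_mult_chi:
  assumes "T \<subseteq> {1..n}"
  shows "(\<Sum>x\<in>cube n. (\<Sum>S\<in>Pow {1..n}. c S * chi S x) * chi T x) = 2 ^ n * c T"
proof -
  have "(\<Sum>x\<in>cube n. (\<Sum>S\<in>Pow {1..n}. c S * chi S x) * chi T x) =
    (\<Sum>S\<in>Pow {1..n}. c S * (\<Sum>x\<in>cube n. chi S x * chi T x))"
    unfolding sum_distrib_right sum_distrib_left by (subst sum.swap) (simp add: mult.assoc)
  also have "\<dots> = (\<Sum>S\<in>Pow {1..n}. if S = T then c S * 2 ^ n else 0)"
    using assms by (intro sum.cong refl) (simp add: sum_cube_prod_mult del: One_nat_def)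
  also have "\<dots> = 2 ^ n * c T" using assms by simp
  finally show ?thesis .
qed

text \<open>Parseval's identity, from orthogonality of the characters.\<close>

lemma sum_cube_expansion_sq:
  "(\<Sum>x\<in>cube n. (\<Sum>S\<in>Pow {1..n}. c S * chi S x) ^ 2) = 2 ^ n * (\<Sum>S\<in>Pow {1..n}. c S ^ 2)"
proof -
  have "(\<Sum>x\<in>cube n. (\<Sum>S\<in>Pow {1..n}. c S * chi S x) ^ 2) =
    (\<Sum>x\<in>cube n. \<Sum>T\<in>Pow {1..n}. c T * ((\<Sum>S\<in>Pow {1..n}. c S * chi S x) * chi T x))"
    unfolding power2_eq_square by (simp only: sum_distrib_left mult_ac)
  also have "\<dots> = (\<Sum>T\<in>Pow {1..n}. c T * (\<Sum>x\<in>cube n. (\<Sum>S\<in>Pow {1..n}. c S * chi S x) * chi T x))"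
    by (subst sum.swap) (simp add: sum_distrib_left)
  also have "\<dots> = (\<Sum>T\<in>Pow {1..n}. 2 ^ n * c T ^ 2)"
    by (intro sum.cong refl)
       (simp add: sum_cube_expansion_mult_chi power2_eq_square del: One_nat_def)
  finally show ?thesis by (simp add: sum_distrib_left)
qed

lemma multilinear_coeff_eq:
  assumes "T \<subseteq> {1..n}"
  shows "multilinear_coeff n f T = (\<Sum>x\<in>cube n. f x * chi T x) / 2 ^ n"
proof -
  have "(\<Sum>x\<in>cube n. f x * chi T x) =
    (\<Sum>x\<in>cube n. (\<Sum>S\<in>Pow {1..n}. multilinear_coeff n f S * chi S x) * chi T x)"
    by (intro sum.cong refl) (simp only: cube_expansion[symmetric])
  also have "\<dots> = 2 ^ n * multilinear_coeff n f T"
    by (rule sum_cube_expansion_mult_chi[OF assms])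
  finally show ?thesis by simp
qed

lemma card_le_cube_degree:
  assumes "S \<subseteq> {1..n}" "multilinear_coeff n f S \<noteq> 0"
  shows "card S \<le> cube_degree n f"
proof -
  have "finite {S. S \<subseteq> {1..n} \<and> multilinear_coeff n f S \<noteq> 0}"
    by (rule finite_subset[of _ "Pow {1..n}"]) auto
  then show ?thesis unfolding cube_degree_def using assms by (intro Max_ge) auto
qed

text \<open>Flipping coordinate \<open>i\<close> negates the characters with
  \<open>i \<in> S\<close> and fixes the others.\<close>

lemma cube_deriv_expansion:
  assumes x: "x \<in> cube n" and i: "i \<in> {1..n}"
  shows "cube_deriv f i x =
    (\<Sum>S\<in>Pow {1..n}. (if i \<in> S then multilinear_coeff n f S else 0) * chi S x)"
proof -
  have "chi S x - chi S (x(i := - x i)) = (if i \<in> S then 2 * chi S x else 0)" if "S \<subseteq> {1..n}" for S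
  proof (cases "i \<in> S")
    case True
    have "finite S" using that finite_subset by blast
    then have "chi S y = y i * chi (S - {i}) y" for y :: "nat \<Rightarrow> real"
      using True by (rule prod.remove)
    moreover have "chi (S - {i}) (x(i := - x i)) = chi (S - {i}) x"
      by (rule prod.cong) auto
    ultimately show ?thesis using True by simp
  next
    case False
    then have "chi S (x(i := - x i)) = chi S x" by (intro prod.cong) auto
    with False show ?thesis by simp
  qed
  then have *: "S \<in> Pow {1..n} \<Longrightarrow> multilinear_coeff n f S * chi S x - multilinear_coeff n f S * chi S (x(i := - x i)) =
     2 * ((if i \<in> S then multilinear_coeff n f S else 0) * chi S x)" for S
    by (simp add: right_diff_distrib[symmetric] del: One_nat_def)
  have "f x - f (x(i := - x i)) = (\<Sum>S\<in>Pow {1..n}. multilinear_coeff n f S * chi S x -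
      multilinear_coeff n f S * chi S (x(i := - x i)))"
    unfolding sum_subtractf cube_expansion[OF x, of f] cube_expansion[OF cube_flip[OF x i], of f] ..
  also have "\<dots> = 2 * (\<Sum>S\<in>Pow {1..n}. (if i \<in> S then multilinear_coeff n f S else 0) * chi S x)"
    unfolding sum_distrib_left by (intro sum.cong refl *)
  finally show ?thesis by (simp add: cube_deriv_def)
qed

lemma sum_cube_deriv:
  assumes i: "i \<in> {1..n}"
  shows "(\<Sum>x\<in>cube n. x i * cube_deriv f i x) = 2 ^ n * multilinear_coeff n f {i}"
proof -
  have "(\<Sum>x\<in>cube n. x i * cube_deriv f i x) = (\<Sum>x\<in>cube n.
    (\<Sum>S\<in>Pow {1..n}. (if i \<in> S then multilinear_coeff n f S else 0) * chi S x) * chi {i} x)"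
    by (intro sum.cong refl) (simp add: cube_deriv_expansion[OF _ i])
  also have "\<dots> = 2 ^ n * multilinear_coeff n f {i}"
    using i by (subst sum_cube_expansion_mult_chi) auto
  finally show ?thesis .
qed

text \<open>By Parseval each \<open>S\<close> is counted once for every element, giving the sum of
  \<open>card S * c\<^sub>S^2\<close>; the factor \<open>card S\<close> is at most the degree
  wherever \<open>c\<^sub>S\<close> is nonzero, and \<open>f^2 <= 1\<close>.\<close>

lemma sum_cube_deriv_sq_le:
  assumes f: "f \<in> cube n \<rightarrow> {-1..1}"
  shows "(\<Sum>i=1..n. \<Sum>x\<in>cube n. cube_deriv f i x ^ 2) \<le> 2 ^ n * real (cube_degree n f)"
proof -
  let ?c = "multilinear_coeff n f"
  have "(\<Sum>i=1..n. \<Sum>x\<in>cube n. cube_deriv f i x ^ 2) =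
      (\<Sum>i=1..n. 2 ^ n * (\<Sum>S\<in>Pow {1..n}. (if i \<in> S then ?c S else 0) ^ 2))"
  proof (rule sum.cong[OF refl])
    fix i assume i: "i \<in> {1..n}"
    have "(\<Sum>x\<in>cube n. cube_deriv f i x ^ 2) =
      (\<Sum>x\<in>cube n. (\<Sum>S\<in>Pow {1..n}. (if i \<in> S then ?c S else 0) * chi S x) ^ 2)"
      by (intro sum.cong refl) (simp only: cube_deriv_expansion[OF _ i])
    then show "(\<Sum>x\<in>cube n. cube_deriv f i x ^ 2) = 2 ^ n * (\<Sum>S\<in>Pow {1..n}. (if i \<in> S then ?c S else 0) ^ 2)"
      by (simp only: sum_cube_expansion_sq)
  qed
  also have "\<dots> = 2 ^ n * (\<Sum>S\<in>Pow {1..n}. \<Sum>i=1..n. if i \<in> S then ?c S ^ 2 else 0)"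
    unfolding sum_distrib_left[symmetric] by (subst sum.swap) (simp add: if_distrib[of "\<lambda>y. y ^ 2"] cong: if_cong)
  also have "(\<Sum>S\<in>Pow {1..n}. \<Sum>i=1..n. if i \<in> S then ?c S ^ 2 else 0) =
      (\<Sum>S\<in>Pow {1..n}. real (card S) * ?c S ^ 2)"
  proof (rule sum.cong[OF refl])
    fix S assume "S \<in> Pow {1..n}"
    then have "{1..n} \<inter> S = S" by auto
    then show "(\<Sum>i=1..n. if i \<in> S then ?c S ^ 2 else 0) = real (card S) * ?c S ^ 2"
      by (simp add: sum.inter_restrict[symmetric])
  qed
  also have "\<dots> \<le> (\<Sum>S\<in>Pow {1..n}. real (cube_degree n f) * ?c S ^ 2)"
  proof (rule sum_mono)
    fix S assume "S \<in> Pow {1..n}"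
    then show "real (card S) * ?c S ^ 2 \<le> real (cube_degree n f) * ?c S ^ 2"
      using card_le_cube_degree[of S n f] by (cases "?c S = 0") (auto intro: mult_right_mono)
  qed
  finally have "(\<Sum>i=1..n. \<Sum>x\<in>cube n. cube_deriv f i x ^ 2) \<le>
      real (cube_degree n f) * (2 ^ n * (\<Sum>S\<in>Pow {1..n}. ?c S ^ 2))"
    by (simp add: sum_distrib_left mult_ac)
  also have "2 ^ n * (\<Sum>S\<in>Pow {1..n}. ?c S ^ 2) = (\<Sum>x\<in>cube n. f x ^ 2)"
    unfolding sum_cube_expansion_sq[symmetric] by (intro sum.cong refl) (simp only: cube_expansion[symmetric])
  also have "real (cube_degree n f) * (\<Sum>x\<in>cube n. f x ^ 2) \<le> real (cube_degree n f) * (\<Sum>x\<in>cube n. 1)"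
  proof (intro mult_left_mono sum_mono)
    fix x assume "x \<in> cube n"
    then have "f x \<in> {-1..1}" using f by blast
    then show "f x ^ 2 \<le> 1" by (auto simp: abs_square_le_1)
  qed simp
  finally show ?thesis by (simp add: card_cube mult.commute)
qed

text \<open>Some permutation of the coordinates maps \<open>S\<close> onto \<open>T\<close>. It
  preserves the coordinate sum, hence \<open>f\<close>, and exchanges the two characters in the
  averages defining the coefficients.\<close>

lemma multilinear_coeff_symmetric:
  assumes f: "cube_symmetric n f" and S: "S \<subseteq> {1..n}" and T: "T \<subseteq> {1..n}" and card: "card S = card T"
  shows "multilinear_coeff n f S = multilinear_coeff n f T"
proof -
  let ?A = "{1..n}"
  have fin: "finite S" "finite T" using S T finite_subset by blast+
  obtain g where g: "bij_betw g S T" using finite_same_card_bij[OF fin card] by blast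
  have "card (?A - S) = card (?A - T)"
    using S T fin card by (simp add: card_Diff_subset)
  then obtain h where h: "bij_betw h (?A - S) (?A - T)"
    using finite_same_card_bij by (metis finite_Diff finite_atLeastAtMost)
  define \<pi> where "\<pi> i = (if i \<in> S then g i else h i)" for i
  have \<pi>S: "bij_betw \<pi> S T"
    using g by (subst bij_betw_cong[of S \<pi> g]) (auto simp: \<pi>_def)
  have "bij_betw \<pi> (?A - S) (?A - T)"
    using h by (subst bij_betw_cong[of "?A - S" \<pi> h]) (auto simp: \<pi>_def)
  from bij_betw_combine[OF \<pi>S this]
  have \<pi>: "bij_betw \<pi> ?A ?A" using S T by (simp add: Un_absorb1)
  define \<sigma> where "\<sigma> = inv_into ?A \<pi>"
  have \<sigma>: "bij_betw \<sigma> ?A ?A" unfolding \<sigma>_def by (rule bij_betw_inv_into[OF \<pi>])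
  have \<pi>\<sigma>: "i \<in> ?A \<Longrightarrow> \<pi> (\<sigma> i) = i" and \<sigma>\<pi>: "i \<in> ?A \<Longrightarrow> \<sigma> (\<pi> i) = i" for i
    unfolding \<sigma>_def using \<pi> by (auto simp: bij_betw_inv_into_right bij_betw_inv_into_left)
  \<comment> \<open>Cube points are extensional functions, so a permuted point must be restricted to
    \<open>{1..n}\<close> again.\<close>
  have in_cube: "(\<lambda>i\<in>?A. x (\<tau> i)) \<in> cube n" if "x \<in> cube n" "bij_betw \<tau> ?A ?A" for x :: "nat \<Rightarrow> real" and \<tau>
  proof -
    have "\<tau> i \<in> ?A" if "i \<in> ?A" for i using \<open>bij_betw \<tau> ?A ?A\<close> that bij_betwE by blast
    then show ?thesis using that(1) by (auto simp: cube_def simp del: atLeastAtMost_iff)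
  qed
  have inv: "(\<lambda>i\<in>?A. (\<lambda>i\<in>?A. x (\<tau> i)) (\<rho> i)) = x"
    if "x \<in> cube n" "\<And>i. i \<in> ?A \<Longrightarrow> \<tau> (\<rho> i) = i" "bij_betw \<rho> ?A ?A" for x :: "nat \<Rightarrow> real" and \<tau> \<rho>
  proof
    fix i
    show "(\<lambda>i\<in>?A. (\<lambda>i\<in>?A. x (\<tau> i)) (\<rho> i)) i = x i"
    proof (cases "i \<in> ?A")
      case True
      then have "\<rho> i \<in> ?A" using that(3) bij_betwE by blast
      then show ?thesis using True that(2) by simp
    next
      case False
      then show ?thesis using that(1) by (auto simp: cube_def PiE_def extensional_def)
    qed
  qed
  have "(\<Sum>x\<in>cube n. f x * chi T x) = (\<Sum>x\<in>cube n. f x * chi S x)"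
  proof (rule sum.reindex_bij_witness[where i = "\<lambda>x. \<lambda>i\<in>?A. x (\<sigma> i)" and j = "\<lambda>x. \<lambda>i\<in>?A. x (\<pi> i)"])
    fix x assume x: "x \<in> cube n"
    show "(\<lambda>i\<in>?A. x (\<pi> i)) \<in> cube n" "(\<lambda>i\<in>?A. x (\<sigma> i)) \<in> cube n"
      by (rule in_cube[OF x \<pi>] in_cube[OF x \<sigma>])+
    show "(\<lambda>i\<in>?A. (\<lambda>i\<in>?A. x (\<pi> i)) (\<sigma> i)) = x" by (rule inv[OF x \<pi>\<sigma> \<sigma>])
    show "(\<lambda>i\<in>?A. (\<lambda>i\<in>?A. x (\<sigma> i)) (\<pi> i)) = x" by (rule inv[OF x \<sigma>\<pi> \<pi>])
    have "(\<Sum>i\<in>?A. (\<lambda>i\<in>?A. x (\<pi> i)) i) = (\<Sum>i\<in>?A. x (\<pi> i))" by (intro sum.cong) auto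
    also have "\<dots> = (\<Sum>i\<in>?A. x i)" by (rule sum.reindex_bij_betw[OF \<pi>])
    finally have "f (\<lambda>i\<in>?A. x (\<pi> i)) = f x"
      using f in_cube[OF x \<pi>] x unfolding cube_symmetric_def by blast
    moreover have "chi S (\<lambda>i\<in>?A. x (\<pi> i)) = (\<Prod>i\<in>S. x (\<pi> i))"
      using S by (intro prod.cong) auto
    moreover have "\<dots> = chi T x" by (rule prod.reindex_bij_betw[OF \<pi>S])
    ultimately show "f (\<lambda>i\<in>?A. x (\<pi> i)) * chi S (\<lambda>i\<in>?A. x (\<pi> i)) = f x * chi T x"
      by simp
  qed
  then show ?thesis by (simp only: multilinear_coeff_eq[OF S] multilinear_coeff_eq[OF T])
qed

section \<open>Symmetric functions as polynomials in the coordinate sum\<close>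

text \<open>Elementary symmetric polynomials as coefficients of their generating function, whose
  differential equation is used next.\<close>

lemma coeff_prod_linear:
  fixes x :: "nat \<Rightarrow> real"
  assumes "finite A"
  shows "coeff (\<Prod>i\<in>A. [:1, x i:]) k = (\<Sum>S | S \<subseteq> A \<and> card S = k. chi S x)"
proof -
  have "(\<Prod>i\<in>A. [:1, x i:]) = (\<Prod>i\<in>A. monom (x i) 1 + 1)"
    by (intro prod.cong refl) (simp add: monom_altdef one_pCons)
  also have "\<dots> = (\<Sum>S\<in>Pow A. \<Prod>i\<in>S. monom (x i) 1)"
    by (subst prod_add[OF assms]) simp
  also have "\<dots> = (\<Sum>S\<in>Pow A. monom (chi S x) (card S))"
  proof (rule sum.cong[OF refl])
    fix S assume "S \<in> Pow A"
    then have "finite S" using assms finite_subset by blast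
    then show "(\<Prod>i\<in>S. monom (x i) 1) = monom (chi S x) (card S)"
      by induction (simp_all add: mult_monom)
  qed
  finally have "coeff (\<Prod>i\<in>A. [:1, x i:]) k = (\<Sum>S\<in>Pow A. if card S = k then chi S x else 0)"
    by (simp add: coeff_sum)
  also have "\<dots> = (\<Sum>S | S \<subseteq> A \<and> card S = k. chi S x)"
    using assms by (subst sum.inter_filter[symmetric]) (auto simp: Collect_conj_eq Pow_def)
  finally show ?thesis .
qed

text \<open>On the cube, \<open>P = \<Prod>\<^sub>i (1 + x\<^sub>i z)\<close> satisfies \<open>(1 - z\<^sup>2) P' = (\<Sum>\<^sub>i x\<^sub>i - n z) P\<close>,
  which yields a three-term recurrence for the elementary symmetric polynomials.\<close>

lemma elementary_symmetric_rec:
  fixes x :: "nat \<Rightarrow> real"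
  assumes x: "x \<in> cube n"
  defines "E \<equiv> coeff (\<Prod>i=1..n. [:1, x i:])" and "s \<equiv> \<Sum>i=1..n. x i"
  shows "E 1 = s" "real (k + 2) * E (k + 2) = s * E (k + 1) - (real n - real k) * E k"
proof -
  define P where "P = (\<Prod>i=1..n. [:1, x i:])"
  have "[:1, 0, -1:] * pderiv P = (\<Sum>a=1..n. [:x a, -1:] * P)"
    unfolding P_def pderiv_prod sum_distrib_left
  proof (rule sum.cong[OF refl])
    fix a assume a: "a \<in> {1..n}"
    let ?R = "\<Prod>i\<in>{1..n}-{a}. [:1, x i:]"
    \<comment> \<open>Since \<open>x a\<close> is a sign, \<open>1 - z^2\<close> factors through
      \<open>1 + x\<^sub>a z\<close> for every \<open>a\<close>; this restores the factor lost in
      differentiating.\<close>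
    have 1: "[:1, 0, -1:] = [:1, - x a:] * [:1, x a:]"
      using cube_coord_sq[OF x a] by simp
    have 2: "pderiv [:1, x a:] = [:x a:]"
      by (simp add: pderiv_pCons)
    have 3: "(\<Prod>i=1..n. [:1, x i:]) = [:1, x a:] * ?R"
      using a by (intro prod.remove) auto
    have 4: "[:1, - x a:] * [:x a:] = [:x a, -1:]"
      using cube_coord_sq[OF x a] by simp
    have "[:1, 0, -1:] * (?R * pderiv [:1, x a:]) = ([:1, - x a:] * [:x a:]) * ([:1, x a:] * ?R)"
      unfolding 1 2 by (simp only: mult_ac)
    then show "[:1, 0, -1:] * (?R * pderiv [:1, x a:]) = [:x a, -1:] * (\<Prod>i=1..n. [:1, x i:])"
      by (simp only: 3 4)
  qed
  also have "\<dots> = (\<Sum>a=1..n. [:x a, -1:]) * P" by (simp only: sum_distrib_right)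
  also have "(\<Sum>a=1..n. [:x a, -1:]) = [:s, - real n:]"
  proof -
    have "(\<Sum>a\<in>A. [:x a, -1:]) = [:\<Sum>a\<in>A. x a, - real (card A):]" if "finite A" for A
      using that by induction auto
    then show ?thesis by (simp add: s_def)
  qed
  finally have ode: "[:1, 0, -1:] * pderiv P = [:s, - real n:] * P" .
  have E: "E k = coeff P k" for k by (simp add: E_def P_def)
  have "coeff P 0 = 1"
    unfolding P_def using poly_prod[of "\<lambda>i. [:1, x i:]" "{1..n}" 0] by (simp add: poly_0_coeff_0)
  then show "E 1 = s"
    using arg_cong[OF ode, of "\<lambda>p. coeff p 0"] by (simp add: E coeff_pderiv)
  show "real (k + 2) * E (k + 2) = s * E (k + 1) - (real n - real k) * E k"
    using arg_cong[OF ode, of "\<lambda>p. coeff p (Suc k)"]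
    by (cases k) (simp_all add: E coeff_pderiv algebra_simps)
qed

text \<open>Strong induction along the recurrence: the multiplication by the coordinate sum raises
  the degree by one, and one polynomial serves all cube points.\<close>

lemma elementary_symmetric_poly_sum:
  "\<exists>p::real poly. degree p \<le> k \<and>
    (\<forall>x\<in>cube n. coeff (\<Prod>i=1..n. [:1, x i:]) k = poly p (\<Sum>i=1..n. x i))"
proof (induction k rule: less_induct)
  case (less k)
  consider "k = 0" | "k = 1" | j where "k = j + 2"
    by (metis One_nat_def add_2_eq_Suc' not0_implies_Suc)
  then show ?case
  proof cases
    case 1
    have "coeff (\<Prod>i=1..n. [:1, x i:]) 0 = 1" for x :: "nat \<Rightarrow> real"
      using poly_prod[of "\<lambda>i. [:1, x i:]" "{1..n}" 0] by (simp add: poly_0_coeff_0)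
    then show ?thesis using 1 by (intro exI[of _ 1]) simp
  next
    case 2
    then show ?thesis using elementary_symmetric_rec(1)[of _ n] by (intro exI[of _ "[:0, 1:]"]) simp
  next
    case 3
    obtain p q where p: "degree p \<le> j" "\<And>x. x\<in>cube n \<Longrightarrow> coeff (\<Prod>i=1..n. [:1, x i:]) j = poly p (\<Sum>i=1..n. x i)"
      and q: "degree q \<le> j + 1" "\<And>x. x\<in>cube n \<Longrightarrow> coeff (\<Prod>i=1..n. [:1, x i:]) (j + 1) = poly q (\<Sum>i=1..n. x i)"
      using less[of j] less[of "j + 1"] 3 by auto
    let ?r = "smult (1 / real (j + 2)) ([:0, 1:] * q - smult (real n - real j) p)"
    have "degree ([:0, 1:] * q) \<le> j + 2"
      using degree_mult_le[of "[:0, 1:]" q] q(1) by simp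
    then have "degree ?r \<le> k"
      unfolding 3 using p(1)
      by (intro order_trans[OF degree_smult_le] degree_diff_le) auto
    moreover have "coeff (\<Prod>i=1..n. [:1, x i:]) k = poly ?r (\<Sum>i=1..n. x i)" if x: "x \<in> cube n" for x
    proof -
      have "real (j + 2) * coeff (\<Prod>i=1..n. [:1, x i:]) k =
        (\<Sum>i=1..n. x i) * poly q (\<Sum>i=1..n. x i) - (real n - real j) * poly p (\<Sum>i=1..n. x i)"
        using elementary_symmetric_rec(2)[OF x, of j] unfolding 3 p(2)[OF x] q(2)[OF x] .
      then have "coeff (\<Prod>i=1..n. [:1, x i:]) k = ((\<Sum>i=1..n. x i) * poly q (\<Sum>i=1..n. x i) - (real n - real j) * poly p (\<Sum>i=1..n. x i)) / real (j + 2)"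
        by (simp add: field_simps)
      then show ?thesis by simp
    qed
    ultimately show ?thesis by blast
  qed
qed

text \<open>Coefficients depend only on \<open>card S\<close>, so \<open>f\<close> is a combination
  of elementary symmetric polynomials, with \<open>{1..k}\<close> representing the sets of size
  \<open>k\<close>. Those with \<open>k\<close> above the degree have coefficient
  \<open>0\<close>.\<close>

lemma symmetric_eq_poly_sum:
  assumes f: "cube_symmetric n f"
  shows "\<exists>p::real poly. degree p \<le> cube_degree n f \<and> (\<forall>x\<in>cube n. f x = poly p (\<Sum>i=1..n. x i))"
proof -
  let ?c = "multilinear_coeff n f"
  obtain e where e: "\<And>k. degree (e k) \<le> k"
    "\<And>k x. x \<in> cube n \<Longrightarrow> coeff (\<Prod>i=1..n. [:1, x i:]) k = poly (e k) (\<Sum>i=1..n. x i)"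
    using elementary_symmetric_poly_sum[of _ n] by metis
  let ?p = "\<Sum>k\<le>n. smult (?c {1..k}) (e k)"
  have "degree ?p \<le> cube_degree n f"
  proof (rule degree_sum_le)
    fix k assume "k \<in> {..n}"
    then have "{1..k} \<subseteq> {1..n}" by auto
    then have "?c {1..k} = 0 \<or> k \<le> cube_degree n f"
      using card_le_cube_degree[of "{1..k}" n f] by auto
    then show "degree (smult (?c {1..k}) (e k)) \<le> cube_degree n f"
      using e(1)[of k] by auto
  qed simp
  moreover have "f x = poly ?p (\<Sum>i=1..n. x i)" if x: "x \<in> cube n" for x
  proof -
    have "f x = (\<Sum>S\<in>Pow {1..n}. ?c S * chi S x)" by (rule cube_expansion[OF x])
    also have "\<dots> = (\<Sum>k\<le>n. \<Sum>S | S \<in> Pow {1..n} \<and> card S = k. ?c S * chi S x)"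
      by (rule sum.group[symmetric]) (use card_mono[of "{1..n}"] in auto)
    also have "\<dots> = (\<Sum>k\<le>n. ?c {1..k} * (\<Sum>S | S \<subseteq> {1..n} \<and> card S = k. chi S x))"
      unfolding sum_distrib_left
    proof (intro sum.cong)
      fix k S assume "k \<in> {..n}" "S \<in> {S. S \<subseteq> {1..n} \<and> card S = k}"
      then show "?c S * chi S x = ?c {1..k} * chi S x"
        using multilinear_coeff_symmetric[OF f, of S "{1..k}"] by auto
    qed auto
    also have "\<dots> = poly ?p (\<Sum>i=1..n. x i)"
      by (simp add: poly_sum coeff_prod_linear[symmetric] e(2)[OF x] flip: One_nat_def)
    finally show ?thesis .
  qed
  ultimately show ?thesis by blast
qed

text \<open>The polynomial \<open>\<Sum>\<^sub>S c\<^sub>S \<rho>\<^bsup>card S\<^esup>\<close> is the multilinear extension of \<open>f\<close> on the diagonal, that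
  is, the mean of \<open>f\<close> under the product measure with coordinate means \<open>\<rho>\<close>.\<close>

lemma abs_sum_linear_coeffs_le:
  assumes f: "f \<in> cube n \<rightarrow> {-1..1}"
  shows "\<bar>\<Sum>i=1..n. multilinear_coeff n f {i}\<bar> \<le> real (cube_degree n f)"
proof -
  let ?c = "multilinear_coeff n f"
  define q where "q = (\<Sum>S\<in>Pow {1..n}. monom (?c S) (card S))"
  have deg: "degree q \<le> cube_degree n f"
    unfolding q_def
  proof (rule degree_sum_le)
    fix S assume "S \<in> Pow {1..n}"
    then show "degree (monom (?c S) (card S)) \<le> cube_degree n f"
      using card_le_cube_degree[of S n f] by (cases "?c S = 0") (auto simp: degree_monom_eq)
  qed simp
  have "\<bar>poly q \<rho>\<bar> \<le> 1" if \<rho>: "\<bar>\<rho>\<bar> \<le> 1" for \<rho>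
  proof -
    \<comment> \<open>The density of the product measure on the cube with coordinate means
      \<open>\<rho>\<close>; its moment against \<open>chi S\<close> is
      \<open>\<rho> ^ card S\<close>, and \<open>S = {}\<close> shows total mass
      \<open>1\<close>.\<close>
    define w where "w x = (\<Prod>i=1..n. (1 + \<rho> * x i) / 2)" for x
    have w0: "w x \<ge> 0" if x: "x \<in> cube n" for x
      unfolding w_def
    proof (rule prod_nonneg)
      fix i assume "i \<in> {1..n}"
      then have "x i = 1 \<or> x i = -1" using cube_coord[OF x] by blast
      then show "0 \<le> (1 + \<rho> * x i) / 2" using \<rho> by auto
    qed
    have wS: "(\<Sum>x\<in>cube n. w x * chi S x) = \<rho> ^ card S" if S: "S \<subseteq> {1..n}" for S
    proof -
      have "chi S x = (\<Prod>i=1..n. if i \<in> S then x i else 1)" for x :: "nat \<Rightarrow> real"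
        using S by (simp add: prod.inter_restrict[symmetric] Int_absorb1)
      then have "(\<Sum>x\<in>cube n. w x * chi S x) =
         (\<Sum>x\<in>cube n. \<Prod>i=1..n. (1 + \<rho> * x i) / 2 * (if i \<in> S then x i else 1))"
        by (simp only: w_def prod.distrib)
      also have "\<dots> = (\<Prod>i=1..n. \<Sum>y\<in>{-1, 1}. (1 + \<rho> * y) / 2 * (if i \<in> S then y else 1))"
        unfolding cube_def by (rule prod_sum_PiE[symmetric]) auto
      also have "\<dots> = (\<Prod>i=1..n. if i \<in> S then \<rho> else 1)"
        by (intro prod.cong) (auto simp: field_simps)
      also have "\<dots> = \<rho> ^ card S"
        using S by (simp add: prod.inter_restrict[symmetric] Int_absorb1)
      finally show ?thesis .
    qed
    have "poly q \<rho> = (\<Sum>S\<in>Pow {1..n}. ?c S * (\<Sum>x\<in>cube n. w x * chi S x))"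
      by (simp add: q_def poly_sum poly_monom wS del: One_nat_def)
    also have "\<dots> = (\<Sum>x\<in>cube n. w x * (\<Sum>S\<in>Pow {1..n}. ?c S * chi S x))"
      unfolding sum_distrib_left by (subst sum.swap) (simp add: mult_ac)
    also have "\<dots> = (\<Sum>x\<in>cube n. w x * f x)"
      by (intro sum.cong refl) (simp only: cube_expansion[symmetric])
    also have "\<bar>\<dots>\<bar> \<le> (\<Sum>x\<in>cube n. w x)"
    proof (rule order_trans[OF sum_abs], rule sum_mono)
      fix x assume x: "x \<in> cube n"
      then have "f x \<in> {-1..1}" using f by blast
      then have "\<bar>f x\<bar> \<le> 1" by auto
      then show "\<bar>w x * f x\<bar> \<le> w x"
        using w0[OF x] by (simp add: abs_mult mult_left_le)
    qed
    also have "\<dots> = 1" using wS[of "{}"] by simp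
    finally show ?thesis .
  qed
  from poly_derivative_at_0_le[OF deg this]
  have "\<bar>coeff q 1\<bar> \<le> real (cube_degree n f)" by simp
  also have "coeff q 1 = (\<Sum>S\<in>Pow {1..n}. if card S = 1 then ?c S else 0)"
    by (simp add: q_def coeff_sum)
  also have "\<dots> = (\<Sum>S\<in>{S \<in> Pow {1..n}. card S = 1}. ?c S)"
    by (rule sum.inter_filter[symmetric]) simp
  also have "{S \<in> Pow {1..n}. card S = 1} = (\<lambda>i. {i}) ` {1..n}"
    by (auto simp: card_Suc_eq image_iff)
  also have "(\<Sum>S\<in>(\<lambda>i. {i}) ` {1..n}. ?c S) = (\<Sum>i=1..n. ?c {i})"
    by (subst sum.reindex) auto
  finally show ?thesis .
qed

text \<open>Every grid point is a coordinate mean, so the bound on \<open>f\<close> passes to the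
  polynomial on the grid.\<close>

lemma ex_cube_sum:
  assumes "m \<le> n"
  shows "\<exists>x\<in>cube n. (\<Sum>i=1..n. x i) = real n - 2 * real m"
proof (intro bexI)
  let ?x = "\<lambda>i\<in>{1..n}. if i \<le> m then -1 else 1 :: real"
  show "?x \<in> cube n" by (auto simp: cube_def)
  have "(\<Sum>i=1..n. ?x i) = (\<Sum>i=1..n. 1 - (if i \<in> {1..m} then 2 else 0))"
    by (intro sum.cong) auto
  also have "\<dots> = real n - (\<Sum>i\<in>{1..n} \<inter> {1..m}. 2)"
    by (simp only: sum_subtractf sum.inter_restrict[symmetric] finite_atLeastAtMost) simp
  also have "{1..n} \<inter> {1..m} = {1..m}" using assms by auto
  finally show "(\<Sum>i=1..n. ?x i) = real n - 2 * real m" by simp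
qed

section \<open>Concentration and the influence\<close>

text \<open>Hoeffding's lemma for a fair sign: with probability \<open>1/2\<close> and range
  \<open>2 y\<close> its left side is \<open>ln (cosh y)\<close> and its right side
  \<open>(2 y)^2 / 8\<close>.\<close>

lemma cosh_le_exp_sq: "cosh y \<le> exp (y ^ 2 / 2)" for y :: real
proof -
  have *: "cosh y \<le> exp (y ^ 2 / 2)" if "y \<ge> 0" for y :: real
  proof -
    have "- (2 * y) * (1 / 2) + ln (1 + (1 / 2) * (exp (2 * y) - 1)) \<le> (2 * y)\<^sup>2 / 8"
      by (rule Hoeffdings_lemma_aux) (use that in auto)
    moreover have "1 + (1 / 2) * (exp (2 * y) - 1) = exp y * cosh y"
      by (simp add: cosh_field_def field_simps mult_exp_exp)
    ultimately have "ln (cosh y) \<le> y ^ 2 / 2"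
      by (simp add: ln_mult cosh_real_pos power2_eq_square)
    then show ?thesis by (metis cosh_real_pos exp_le_cancel_iff exp_ln)
  qed
  show ?thesis using *[of y] *[of "- y"] by (cases "y \<ge> 0") auto
qed

lemma sum_cube_exp:
  "(\<Sum>x\<in>cube n. exp (l * (\<Sum>i=1..n. x i))) \<le> 2 ^ n * exp (real n * l ^ 2 / 2)"
proof -
  have "(\<Sum>x\<in>cube n. exp (l * (\<Sum>i=1..n. x i))) = (\<Sum>x\<in>cube n. \<Prod>i=1..n. exp (l * x i))"
    by (simp add: sum_distrib_left exp_sum)
  also have "\<dots> = (\<Prod>i=1..n. \<Sum>y\<in>{-1, 1}. exp (l * y))"
    unfolding cube_def by (rule prod_sum_PiE[symmetric]) auto
  also have "(\<Sum>y\<in>{-1, 1}. exp (l * y)) = 2 * cosh l"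
    by (simp add: cosh_field_def)
  also have "(\<Prod>i=1..n. 2 * cosh l) = (2 * cosh l) ^ n" by simp
  also have "\<dots> \<le> (2 * exp (l ^ 2 / 2)) ^ n"
    by (intro power_mono mult_left_mono cosh_le_exp_sq) (auto simp: cosh_real_nonneg)
  also have "\<dots> = 2 ^ n * exp (real n * l ^ 2 / 2)"
    by (simp add: power_mult_distrib exp_of_nat_mult[symmetric])
  finally show ?thesis .
qed

text \<open>Chernoff's method with the optimal parameter \<open>b\<close>; adding the exponentials
  for \<open>b\<close> and \<open>- b\<close> covers both tails.\<close>

lemma card_cube_tail_le:
  assumes "b \<ge> 0"
  shows "real (card {x \<in> cube n. \<bar>\<Sum>i=1..n. x i\<bar> > real n * b}) \<le> 2 ^ n * (2 * exp (- (real n * b ^ 2 / 2)))"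
proof -
  let ?s = "\<lambda>x. \<Sum>i=1..n. x i :: real" and ?c = "exp (- (real n * b ^ 2))"
  have "real (card {x \<in> cube n. \<bar>?s x\<bar> > real n * b}) = (\<Sum>x\<in>cube n. if \<bar>?s x\<bar> > real n * b then 1 else 0)"
    by (simp add: sum.inter_filter[symmetric])
  also have "\<dots> \<le> (\<Sum>x\<in>cube n. ?c * (exp (b * ?s x) + exp ((- b) * ?s x)))"
  proof (rule sum_mono)
    fix x
    show "(if \<bar>?s x\<bar> > real n * b then 1 else 0) \<le> ?c * (exp (b * ?s x) + exp ((- b) * ?s x))"
    proof (cases "\<bar>?s x\<bar> > real n * b")
      case True
      have "real n * b ^ 2 \<le> b * \<bar>?s x\<bar>"
        using mult_left_mono[OF less_imp_le[OF True] assms] by (simp add: power2_eq_square mult_ac)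
      then have "1 \<le> ?c * exp (b * \<bar>?s x\<bar>)"
        by (simp add: mult_exp_exp)
      also have "\<dots> \<le> ?c * (exp (b * ?s x) + exp ((- b) * ?s x))"
        by (intro mult_left_mono) (auto simp: abs_if)
      finally show ?thesis using True by simp
    next
      case False
      then show ?thesis by (simp add: add_nonneg_nonneg)
    qed
  qed
  also have "\<dots> \<le> ?c * (2 ^ n * exp (real n * b ^ 2 / 2) + 2 ^ n * exp (real n * (- b) ^ 2 / 2))"
    unfolding sum_distrib_left[symmetric] sum.distrib
    by (intro mult_left_mono add_mono sum_cube_exp) auto
  also have "\<dots> = 2 ^ n * (2 * (?c * exp (real n * b ^ 2 / 2)))" by simp
  also have "?c * exp (real n * b ^ 2 / 2) = exp (- (real n * b ^ 2 / 2))"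
    by (simp add: mult_exp_exp field_simps)
  finally show ?thesis .
qed

section \<open>Influence inside and outside a window\<close>

text \<open>Cauchy--Schwarz over the pairs \<open>(i, x)\<close> in
  \<open>{1..n} \<times> A\<close>, with the total square mass of the derivatives bounded by the
  degree.\<close>

lemma sum_abs_cube_deriv_le:
  assumes f: "f \<in> cube n \<rightarrow> {-1..1}" and A: "A \<subseteq> cube n" and card: "real (card A) \<le> 2 ^ n * r"
  shows "(\<Sum>i=1..n. \<Sum>x\<in>A. \<bar>cube_deriv f i x\<bar>) \<le> 2 ^ n * sqrt (real (cube_degree n f) * real n * r)"
proof -
  let ?g = "\<lambda>(i, x). cube_deriv f i x" and ?I = "{1..n} \<times> A"
  have "(\<Sum>i=1..n. \<Sum>x\<in>A. \<bar>cube_deriv f i x\<bar>) = (\<Sum>z\<in>?I. \<bar>?g z\<bar> * \<bar>1\<bar>)"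
    by (simp add: sum.cartesian_product case_prod_unfold)
  also have "\<dots> \<le> L2_set ?g ?I * L2_set (\<lambda>_. 1) ?I"
    by (rule L2_set_mult_ineq)
  also have "L2_set (\<lambda>_. 1) ?I = sqrt (real n * real (card A))"
    by (simp add: L2_set_def card_cartesian_product)
  also have "L2_set ?g ?I = sqrt (\<Sum>i=1..n. \<Sum>x\<in>A. cube_deriv f i x ^ 2)"
    by (simp add: L2_set_def sum.cartesian_product case_prod_unfold)
  also have "sqrt (\<Sum>i=1..n. \<Sum>x\<in>A. cube_deriv f i x ^ 2) * sqrt (real n * real (card A)) \<le>
      sqrt (2 ^ n * real (cube_degree n f)) * sqrt (real n * (2 ^ n * r))"
  proof (intro mult_mono real_sqrt_le_mono mult_left_mono card)
    have "(\<Sum>i=1..n. \<Sum>x\<in>A. cube_deriv f i x ^ 2) \<le> (\<Sum>i=1..n. \<Sum>x\<in>cube n. cube_deriv f i x ^ 2)"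
      using A by (intro sum_mono sum_mono2) auto
    also have "\<dots> \<le> 2 ^ n * real (cube_degree n f)" by (rule sum_cube_deriv_sq_le[OF f])
    finally show "(\<Sum>i=1..n. \<Sum>x\<in>A. cube_deriv f i x ^ 2) \<le> 2 ^ n * real (cube_degree n f)" .
  qed auto
  also have "\<dots> = sqrt ((2 ^ n) ^ 2 * (real (cube_degree n f) * real n * r))"
    by (simp add: real_sqrt_mult[symmetric] power2_eq_square mult_ac)
  also have "\<dots> = 2 ^ n * sqrt (real (cube_degree n f) * real n * r)"
    by (subst real_sqrt_mult) (simp add: real_sqrt_abs)
  finally show ?thesis .
qed

text \<open>On \<open>W\<close> the absolute value equals
  \<open>\<epsilon> * x i * cube_deriv f i x\<close>; off \<open>W\<close> the same substitution
  costs at most twice the absolute value. The signed sum over the whole cube is a sum of linear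
  coefficients.\<close>

lemma sum_abs_cube_deriv_monotone:
  assumes f: "f \<in> cube n \<rightarrow> {-1..1}" and \<epsilon>: "\<bar>\<epsilon>\<bar> = 1"
    and W: "\<And>i x. i \<in> {1..n} \<Longrightarrow> x \<in> W \<Longrightarrow> x \<in> cube n \<Longrightarrow> 0 \<le> \<epsilon> * (x i * cube_deriv f i x)"
  shows "(\<Sum>i=1..n. \<Sum>x\<in>cube n. \<bar>cube_deriv f i x\<bar>) \<le> 2 ^ n * real (cube_degree n f) +
    2 * (\<Sum>i=1..n. \<Sum>x\<in>cube n - W. \<bar>cube_deriv f i x\<bar>)"
proof -
  have "(\<Sum>i=1..n. \<Sum>x\<in>cube n. \<bar>cube_deriv f i x\<bar>) \<le>
    (\<Sum>i=1..n. \<Sum>x\<in>cube n. \<epsilon> * (x i * cube_deriv f i x) + (if x \<in> - W then 2 * \<bar>cube_deriv f i x\<bar> else 0))"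
  proof (intro sum_mono)
    fix i x assume i: "i \<in> {1..n}" and x: "x \<in> cube n"
    have "\<bar>\<epsilon> * (x i * cube_deriv f i x)\<bar> = \<bar>cube_deriv f i x\<bar>"
      using cube_coord[OF x i] \<epsilon> by (auto simp: abs_mult)
    then show "\<bar>cube_deriv f i x\<bar> \<le> \<epsilon> * (x i * cube_deriv f i x) + (if x \<in> - W then 2 * \<bar>cube_deriv f i x\<bar> else 0)"
      using W[OF i _ x] by (cases "x \<in> W") auto
  qed
  also have "\<dots> = \<epsilon> * (2 ^ n * (\<Sum>i=1..n. multilinear_coeff n f {i})) +
      2 * (\<Sum>i=1..n. \<Sum>x\<in>cube n - W. \<bar>cube_deriv f i x\<bar>)"
  proof -
    have "(\<Sum>i=1..n. \<Sum>x\<in>cube n. \<epsilon> * (x i * cube_deriv f i x)) =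
      \<epsilon> * (2 ^ n * (\<Sum>i=1..n. multilinear_coeff n f {i}))"
      unfolding sum_distrib_left[symmetric]
      by (simp add: sum_cube_deriv sum_distrib_left del: One_nat_def)
    moreover have "(\<Sum>x\<in>cube n. if x \<in> - W then 2 * \<bar>cube_deriv f i x\<bar> else 0) =
        2 * (\<Sum>x\<in>cube n - W. \<bar>cube_deriv f i x\<bar>)" for i
      unfolding sum_distrib_left by (subst sum.inter_restrict[symmetric]) (simp_all add: Diff_eq)
    ultimately show ?thesis by (simp add: sum.distrib sum_distrib_left del: One_nat_def)
  qed
  also have "\<epsilon> * (2 ^ n * (\<Sum>i=1..n. multilinear_coeff n f {i})) \<le> 2 ^ n * real (cube_degree n f)"
  proof -
    have "\<epsilon> * (2 ^ n * (\<Sum>i=1..n. multilinear_coeff n f {i})) \<le>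
      \<bar>\<epsilon> * (2 ^ n * (\<Sum>i=1..n. multilinear_coeff n f {i}))\<bar>" by (rule abs_ge_self)
    also have "\<dots> = 2 ^ n * \<bar>\<Sum>i=1..n. multilinear_coeff n f {i}\<bar>"
      by (simp only: abs_mult \<epsilon>) simp
    finally show ?thesis
      using mult_left_mono[OF abs_sum_linear_coeffs_le[OF f], of "2 ^ n"] by simp
  qed
  finally show ?thesis by simp
qed

lemma sum_abs_cube_deriv_flat:
  assumes W: "\<And>i x. i \<in> {1..n} \<Longrightarrow> x \<in> W \<Longrightarrow> x \<in> cube n \<Longrightarrow> \<bar>cube_deriv f i x\<bar> \<le> r / real n"
    and r: "r \<ge> 0"
  shows "(\<Sum>i=1..n. \<Sum>x\<in>cube n. \<bar>cube_deriv f i x\<bar>) \<le> 2 ^ n * r +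
    (\<Sum>i=1..n. \<Sum>x\<in>cube n - W. \<bar>cube_deriv f i x\<bar>)"
proof -
  have "(\<Sum>i=1..n. \<Sum>x\<in>cube n. \<bar>cube_deriv f i x\<bar>) \<le>
    (\<Sum>i=1..n. \<Sum>x\<in>cube n. r / real n + (if x \<in> - W then \<bar>cube_deriv f i x\<bar> else 0))"
    using W r by (intro sum_mono) auto
  also have "\<dots> = (\<Sum>i=1..n. 2 ^ n * r / real n) + (\<Sum>i=1..n. \<Sum>x\<in>cube n - W. \<bar>cube_deriv f i x\<bar>)"
    by (simp add: sum.distrib card_cube sum.inter_restrict[symmetric] Diff_eq del: Compl_iff)
  \<comment> \<open>Only an inequality, because the sum is empty for \<open>n = 0\<close>.\<close>
  also have "(\<Sum>i=1..n. 2 ^ n * r / real n) \<le> 2 ^ n * r"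
    using r by simp
  finally show ?thesis by simp
qed

theorem theorem3p12:
  shows "\<exists>C::real. \<forall>(n::nat) (d::nat) (f :: (nat \<Rightarrow> real) \<Rightarrow> real).
    f \<in> cube n \<rightarrow> {-1..1} \<longrightarrow>
    cube_symmetric n f \<longrightarrow>
    cube_degree n f = d \<longrightarrow>
    real n \<ge> 64 * real d ^ 4 * ln (real d) \<longrightarrow>
    (let t = sqrt (real n) * (1 / (4 * real d ^ 2) - 2 / real n)
     in total_influence n f \<le> real d + C * sqrt (real d * real n) * exp (- (t ^ 2) / 4))"
proof (intro exI allI impI, unfold Let_def)
  fix n d :: nat and f :: "(nat \<Rightarrow> real) \<Rightarrow> real"
  assume f: "f \<in> cube n \<rightarrow> {-1..1}" and sym: "cube_symmetric n f" and deg: "cube_degree n f = d"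
    and n: "real n \<ge> 64 * real d ^ 4 * ln (real d)"
  \<comment> \<open>Flipping one coordinate moves the mean by \<open>2 / n\<close>, so from
    \<open>[-b, b]\<close> it stays within \<open>1 / (4 d^2)\<close>. With this \<open>b\<close>,
    \<open>t\<close> is \<open>sqrt n * b\<close>.\<close>
  define b where "b = 1 / (4 * real d ^ 2) - 2 / real n"
  define r where "r = sqrt (real d * real n) * exp (- ((sqrt (real n) * b) ^ 2) / 4)"
  obtain p where p: "degree p \<le> d" "\<And>x. x \<in> cube n \<Longrightarrow> f x = poly p (\<Sum>i=1..n. x i)"
    using symmetric_eq_poly_sum[OF sym] deg by blast
  have sum_flip: "(\<Sum>j=1..n. (x(i := - x i)) j) = (\<Sum>j=1..n. x j) - 2 * x i" if "i \<in> {1..n}" for i and x :: "nat \<Rightarrow> real"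
  proof -
    have "(\<Sum>j=1..n. y j) = y i + (\<Sum>j\<in>{1..n} - {i}. y j)" for y :: "nat \<Rightarrow> real"
      using that by (intro sum.remove) auto
    moreover have "(\<Sum>j\<in>{1..n} - {i}. (x(i := - x i)) j) = (\<Sum>j\<in>{1..n} - {i}. x j)"
      by (intro sum.cong) auto
    ultimately show ?thesis by simp
  qed
  \<comment> \<open>The constant is \<open>4\<close>: the tail contributes at most
    \<open>2 * r\<close> and is counted twice in the monotone case.\<close>
  have "(\<Sum>i=1..n. \<Sum>x\<in>cube n. \<bar>cube_deriv f i x\<bar>) \<le> 2 ^ n * (real d + 4 * r)"
  proof (cases "d \<le> 1")
    \<comment> \<open>For \<open>d <= 1\<close> the condition on \<open>n\<close> reads
      \<open>n >= 0\<close>, so \<open>b\<close> may be negative. Instead \<open>f\<close> is affine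
      in the coordinate sum, and the whole cube serves as the window.\<close>
    case True
    have lin: "x i * cube_deriv f i x = coeff p 1" if i: "i \<in> {1..n}" and x: "x \<in> cube n" for i x
    proof -
      have "p = [:coeff p 0, coeff p 1:]"
        using p(1) True by (intro poly_eqI) (auto simp: coeff_pCons coeff_eq_0 split: nat.split)
      then have "poly p u = coeff p 0 + coeff p 1 * u" for u
        by (metis mult.commute poly_pCons poly_0 mult_zero_right add.right_neutral)
      then show ?thesis
        unfolding cube_deriv_def p(2)[OF x] p(2)[OF cube_flip[OF x i]] sum_flip[OF i]
        using cube_coord_sq[OF x i] by (simp add: algebra_simps)
    qed
    have "(\<Sum>i=1..n. \<Sum>x\<in>cube n. \<bar>cube_deriv f i x\<bar>) \<le> 2 ^ n * real (cube_degree n f) +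
      2 * (\<Sum>i=1..n. \<Sum>x\<in>cube n - cube n. \<bar>cube_deriv f i x\<bar>)"
      by (rule sum_abs_cube_deriv_monotone[OF f, of "if coeff p 1 \<ge> 0 then 1 else -1"]) (auto simp: lin)
    also have "\<dots> \<le> 2 ^ n * (real d + 4 * r)"
      by (simp add: deg r_def)
    finally show ?thesis .
  next
    case False
    then have d: "d \<ge> 2" by simp
    define a where "a = 1 / (4 * real d ^ 2)"
    have d2: "real d ^ 2 \<ge> 4" using power_mono[of 2 "real d" 2] d by simp
    \<comment> \<open>From \<open>d^2 >= 4\<close> and \<open>ln d >= 1/2\<close>. This exceeds the
      \<open>16 d^2\<close> of the grid bound and makes \<open>b\<close> nonnegative.\<close>
    have n128: "real n \<ge> 128 * real d ^ 2"
    proof -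
      have "ln (real d) \<ge> ln 2" using d by simp
      then have l: "ln (real d) \<ge> 1 / 2" using ln2_ge_two_thirds by linarith
      have "128 * real d ^ 2 = 64 * (real d ^ 2 * 4) * (1 / 2)" by simp
      also have "\<dots> \<le> 64 * (real d ^ 2 * real d ^ 2) * ln (real d)"
        by (intro mult_mono l d2) auto
      also have "\<dots> = 64 * real d ^ 4 * ln (real d)" by (simp add: power_add[symmetric])
      finally show ?thesis using n by (rule order_trans)
    qed
    then have n0: "real n > 0" using d2 by linarith
    have "2 / real n \<le> 2 / (128 * real d ^ 2)"
      using n128 n0 d by (intro divide_left_mono) auto
    also have "\<dots> \<le> 1 / (4 * real d ^ 2)" using d by (simp add: divide_simps)
    finally have b0: "b \<ge> 0" by (simp add: b_def)
    have ab: "b + 2 / real n = a" by (simp add: a_def b_def)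
    define P where "P = pcompose p [:0, real n:]"
    have P: "degree P \<le> d" using p(1) n0 by (simp add: P_def degree_pcompose)
    have fP: "f x = poly P ((\<Sum>i=1..n. x i) / real n)" if "x \<in> cube n" for x
      using p(2)[OF that] n0 by (simp add: P_def poly_pcompose)
    have grid: "\<bar>poly P ((real n - 2 * real m) / real n)\<bar> \<le> 1" if m: "m \<le> n" for m
    proof -
      obtain x where "x \<in> cube n" "(\<Sum>i=1..n. x i) = real n - 2 * real m"
        using ex_cube_sum[OF m] by blast
      moreover have "f x \<in> {-1..1}" using f \<open>x \<in> cube n\<close> by blast
      ultimately show ?thesis using fP[of x] by auto
    qed
    have P2: "\<bar>poly P u\<bar> \<le> 2" if "\<bar>u\<bar> \<le> 1" for u
      using d n128 by (intro poly_bounded_of_grid[OF _ P _ grid that]) auto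
    define W where "W = {x \<in> cube n. \<bar>\<Sum>i=1..n. x i\<bar> \<le> real n * b}"
    have tail: "(\<Sum>i=1..n. \<Sum>x\<in>cube n - W. \<bar>cube_deriv f i x\<bar>) \<le> 2 ^ n * (2 * r)"
    proof -
      have "cube n - W = {x \<in> cube n. \<bar>\<Sum>i=1..n. x i\<bar> > real n * b}"
        by (auto simp: W_def)
      then have "real (card (cube n - W)) \<le> 2 ^ n * (2 * exp (- (real n * b ^ 2 / 2)))"
        using card_cube_tail_le[OF b0] by simp
      from sum_abs_cube_deriv_le[OF f _ this]
      have "(\<Sum>i=1..n. \<Sum>x\<in>cube n - W. \<bar>cube_deriv f i x\<bar>) \<le>
        2 ^ n * sqrt (real d * real n * (2 * exp (- (real n * b ^ 2 / 2))))"
        by (auto simp: deg)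
      \<comment> \<open>The exponent \<open>t^2 / 4\<close> in \<open>r\<close> arises as the square
        root of the tail measure.\<close>
      also have "real d * real n * (2 * exp (- (real n * b ^ 2 / 2))) = 2 * r ^ 2"
        by (simp add: r_def power_mult_distrib exp_double[symmetric])
      also have "sqrt (2 * r ^ 2) \<le> 2 * r"
        by (rule real_le_lsqrt) (auto simp: r_def power_mult_distrib)
      finally show ?thesis by simp
    qed
    \<comment> \<open>The factor \<open>x i\<close> gives both flip directions the same sign; the
      step \<open>2 / n\<close> and the half in \<open>cube_deriv\<close> leave
      \<open>1 / n\<close>.\<close>
    have mvt: "\<exists>\<xi>. \<bar>\<xi>\<bar> \<le> a \<and> x i * cube_deriv f i x = poly (pderiv P) \<xi> / real n"
      if i: "i \<in> {1..n}" and x: "x \<in> W" "x \<in> cube n" for i x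
    proof -
      define u where "u = (\<Sum>i=1..n. x i) / real n"
      have "\<bar>u\<bar> \<le> b" using x n0 by (simp add: W_def u_def field_simps)
      have dv: "cube_deriv f i x = (poly P u - poly P (u - 2 * x i / real n)) / 2"
        unfolding cube_deriv_def fP[OF x(2)] fP[OF cube_flip[OF x(2) i]] sum_flip[OF i]
        by (simp add: u_def diff_divide_distrib)
      have h: "2 / real n > 0" using n0 by simp
      show ?thesis
      proof (cases "x i = 1")
        case True
        obtain \<xi> where "u - 2 / real n < \<xi>" "\<xi> < u"
          "poly P u - poly P (u - 2 / real n) = (u - (u - 2 / real n)) * poly (pderiv P) \<xi>"
          using poly_MVT[of "u - 2 / real n" u P] h by auto
        then show ?thesis using True dv \<open>\<bar>u\<bar> \<le> b\<close> ab h by (intro exI[of _ \<xi>]) auto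
      next
        case False
        then have xi: "x i = -1" using cube_coord[OF x(2) i] by simp
        obtain \<xi> where "u < \<xi>" "\<xi> < u + 2 / real n"
          "poly P (u + 2 / real n) - poly P u = (u + 2 / real n - u) * poly (pderiv P) \<xi>"
          using poly_MVT[of u "u + 2 / real n" P] h by auto
        then show ?thesis using xi dv \<open>\<bar>u\<bar> \<le> b\<close> ab h by (intro exI[of _ \<xi>]) auto
      qed
    qed
    show ?thesis
    proof (cases "\<exists>\<epsilon>. \<bar>\<epsilon>\<bar> = 1 \<and> (\<forall>u. \<bar>u\<bar> \<le> a \<longrightarrow> 0 \<le> \<epsilon> * poly (pderiv P) u)")
      case True
      then obtain \<epsilon> :: real where \<epsilon>: "\<bar>\<epsilon>\<bar> = 1" "\<And>u. \<bar>u\<bar> \<le> a \<Longrightarrow> 0 \<le> \<epsilon> * poly (pderiv P) u"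
        by blast
      have sgn: "0 \<le> \<epsilon> * (x i * cube_deriv f i x)" if x: "i \<in> {1..n}" "x \<in> W" "x \<in> cube n" for i x
      proof -
        obtain \<xi> where "\<bar>\<xi>\<bar> \<le> a" "x i * cube_deriv f i x = poly (pderiv P) \<xi> / real n"
          using mvt[OF x] by blast
        then show ?thesis using \<epsilon>(2)[of \<xi>] by simp
      qed
      have "(\<Sum>i=1..n. \<Sum>x\<in>cube n. \<bar>cube_deriv f i x\<bar>) \<le> 2 ^ n * real (cube_degree n f) +
        2 * (\<Sum>i=1..n. \<Sum>x\<in>cube n - W. \<bar>cube_deriv f i x\<bar>)"
        by (rule sum_abs_cube_deriv_monotone[OF f \<epsilon>(1)]) (rule sgn)
      also have "\<dots> \<le> 2 ^ n * real d + 2 * (2 ^ n * (2 * r))"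
        unfolding deg by (intro add_left_mono mult_left_mono tail) simp
      also have "\<dots> = 2 ^ n * (real d + 4 * r)" by (simp add: distrib_left)
      finally show ?thesis .
    next
      case False
      have neg: "\<exists>u. \<bar>u\<bar> \<le> a \<and> \<epsilon> * poly (pderiv P) u < 0" if "\<bar>\<epsilon>\<bar> = 1" for \<epsilon>
      proof (rule ccontr)
        assume "\<not> (\<exists>u. \<bar>u\<bar> \<le> a \<and> \<epsilon> * poly (pderiv P) u < 0)"
        then have "\<forall>u. \<bar>u\<bar> \<le> a \<longrightarrow> 0 \<le> \<epsilon> * poly (pderiv P) u" by (simp add: not_less)
        with False that show False by blast
      qed
      obtain u1 u2 where u1: "\<bar>u1\<bar> \<le> a" "poly (pderiv P) u1 < 0"
        and u2: "\<bar>u2\<bar> \<le> a" "poly (pderiv P) u2 > 0"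
        using neg[of 1] neg[of "-1"] by auto
      \<comment> \<open>The window has length \<open>2 a = 1 / (2 d^2)\<close>, so \<open>P'\<close>
        varies by at most \<open>3 / 2\<close>, which is below \<open>d\<close> as
        \<open>d >= 2\<close>.\<close>
      have osc: "\<bar>poly (pderiv P) u - poly (pderiv P) v\<bar> \<le> real d" if uv: "\<bar>u\<bar> \<le> a" "\<bar>v\<bar> \<le> a" for u v
      proof -
        have "norm (poly (pderiv P) u - poly (pderiv P) v) \<le> (3 * real d ^ 2) * norm (u - v)"
        proof (rule field_differentiable_bound[of "{-a..a}"])
          fix z assume "z \<in> {-a..a}"
          then have "\<bar>z\<bar> \<le> 1 / (4 * real d ^ 2)" by (auto simp: a_def)
          then show "norm (poly (pderiv (pderiv P)) z) \<le> 3 * real d ^ 2"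
            using poly_second_derivative_central[OF d P P2] by simp
        qed (use uv in \<open>auto intro: poly_DERIV has_field_derivative_at_within\<close>)
        also have "\<dots> \<le> (3 * real d ^ 2) * (2 * a)"
          using uv by (intro mult_left_mono) auto
        also have "\<dots> \<le> real d" using d by (simp add: a_def)
        finally show ?thesis by simp
      qed
      \<comment> \<open>Comparison with a negative value bounds \<open>P'\<close> above by
        \<open>d\<close>, comparison with a positive one bounds it below by
        \<open>- d\<close>.\<close>
      have flat: "\<bar>poly (pderiv P) u\<bar> \<le> real d" if "\<bar>u\<bar> \<le> a" for u
        using osc[OF that u1(1)] osc[OF that u2(1)] u1(2) u2(2) by linarith
      have "\<bar>cube_deriv f i x\<bar> \<le> real d / real n" if x: "i \<in> {1..n}" "x \<in> W" "x \<in> cube n" for i x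
      proof -
        obtain \<xi> where \<xi>: "\<bar>\<xi>\<bar> \<le> a" "x i * cube_deriv f i x = poly (pderiv P) \<xi> / real n"
          using mvt[OF x] by blast
        have "\<bar>cube_deriv f i x\<bar> = \<bar>x i * cube_deriv f i x\<bar>"
          using cube_coord[OF x(3,1)] by auto
        then show ?thesis using flat[OF \<xi>(1)] n0 \<xi>(2) by (simp add: divide_right_mono)
      qed
      then have "(\<Sum>i=1..n. \<Sum>x\<in>cube n. \<bar>cube_deriv f i x\<bar>) \<le> 2 ^ n * real d +
        (\<Sum>i=1..n. \<Sum>x\<in>cube n - W. \<bar>cube_deriv f i x\<bar>)"
        by (rule sum_abs_cube_deriv_flat) simp_all
      also have "\<dots> \<le> 2 ^ n * real d + 2 ^ n * (2 * r)"
        by (intro add_left_mono tail)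
      also have "\<dots> \<le> 2 ^ n * (real d + 4 * r)"
        by (simp add: distrib_left r_def)
      finally show ?thesis .
    qed
  qed
  then have "total_influence n f \<le> real d + 4 * r"
    by (simp add: total_influence_eq field_simps)
  then show "total_influence n f \<le> real d + 4 * sqrt (real d * real n) *
      exp (- ((sqrt (real n) * (1 / (4 * real d ^ 2) - 2 / real n)) ^ 2) / 4)"
    by (simp add: r_def b_def mult.assoc)
qed

end
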